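(* Let $\mathsf P$ be a principle having an $\omega$-model all of whose members are low${}_2$ sets, and such that $\mathsf{STS}(2) \leq_c \mathsf P$ or $\mathsf{SADS} \leq_c \mathsf P$. Then $\mathsf P$ admits no universal instance.
   Context: A principle $\mathsf{P}$ is a statement $\forall X(\Phi(X) \to \exists Y \Psi(X,Y))$ ($\Phi,\Psi$ arithmetical) with instances $X$ and solutions $Y$. A degree bounds $\mathsf P$ if every computable instance has a solution computable in it; $\mathsf P$ admits a universal instance if some computable instance has all its solutions bounding $\mathsf P$. $\mathsf{P} \leq_c \mathsf{Q}$ if every instance $X$ of $\mathsf P$ computes an instance $Y$ of $\mathsf Q$ such that every solution to $Y$ computes, together with $X$, a solution to $X$. An $\omega$-model of $\mathsf P$ is a nonempty collection of sets closed under $\oplus$ and $\leq_T$ in which every instance of $\mathsf P$ has a solution. $X$ is low${}_2$ if $X''\leq_T\emptyset''$. $\mathsf{STS}(2)$: every stable $g:[\omega]^2\to\omega$ (i.e. $\lim_s g(x,s)$ exists for all $x$) has an infinite set $A$ with $g([A]^2)\neq \omega$. $\mathsf{SADS}$: every linear order on $\omega$ in which every element has finitely many predecessors or finitely many successors has an infinite ascending or descending sequence. *)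

theory Defs
  imports Main "HOL-Library.Nat_Bijection"
begin

datatype rf = Zero | Succ | Proj nat | Oracle | Comp rf "rf list" | Prec rf rf | Mu rf

inductive eval :: "nat set \<Rightarrow> rf \<Rightarrow> nat list \<Rightarrow> nat \<Rightarrow> bool" for A where
  ev_zero: "eval A Zero xs 0"
| ev_succ: "eval A Succ (x # xs) (Suc x)"
| ev_proj: "i < length xs \<Longrightarrow> eval A (Proj i) xs (xs ! i)"
| ev_orc: "eval A Oracle (x # xs) (if x \<in> A then 1 else 0)"
| ev_comp: "length ys = length gs \<Longrightarrow> (\<forall>i<length gs. eval A (gs ! i) xs (ys ! i))
            \<Longrightarrow> eval A f ys v \<Longrightarrow> eval A (Comp f gs) xs v"
| ev_prec0: "eval A f xs v \<Longrightarrow> eval A (Prec f g) (0 # xs) v"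
| ev_precS: "eval A (Prec f g) (n # xs) u \<Longrightarrow> eval A g (n # u # xs) v
            \<Longrightarrow> eval A (Prec f g) (Suc n # xs) v"
| ev_mu: "eval A f (n # xs) 0 \<Longrightarrow> (\<forall>m<n. \<exists>k. eval A f (m # xs) (Suc k))
            \<Longrightarrow> eval A (Mu f) xs n"

fun enc :: "rf \<Rightarrow> nat" where
  "enc Zero = prod_encode (0, 0)"
| "enc Succ = prod_encode (1, 0)"
| "enc (Proj i) = prod_encode (2, i)"
| "enc Oracle = prod_encode (3, 0)"
| "enc (Comp f gs) = prod_encode (4, prod_encode (enc f, list_encode (map enc gs)))"
| "enc (Prec f g) = prod_encode (5, prod_encode (enc f, enc g))"
| "enc (Mu f) = prod_encode (6, enc f)"

definition turing_le :: "nat set \<Rightarrow> nat set \<Rightarrow> bool" where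
  "turing_le B A \<longleftrightarrow> (\<exists>c. \<forall>n. eval A c [n] (if n \<in> B then 1 else 0))"

definition jump :: "nat set \<Rightarrow> nat set" where
  "jump A = {n. \<exists>c v. n = enc c \<and> eval A c [n] v}"

definition join :: "nat set \<Rightarrow> nat set \<Rightarrow> nat set" where
  "join A B = {2 * n | n. n \<in> A} \<union> {2 * n + 1 | n. n \<in> B}"

definition low2 :: "nat set \<Rightarrow> bool" where
  "low2 X \<longleftrightarrow> turing_le (jump (jump X)) (jump (jump {}))"

datatype atm = AVar nat | AZero | ASuc atm | APlus atm atm | ATimes atm atm
datatype afm = AEq atm atm | AMem nat atm | ANot afm | AAnd afm afm | AEx afm

fun tval :: "(nat \<Rightarrow> nat) \<Rightarrow> atm \<Rightarrow> nat" where
  "tval e (AVar i) = e i"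
| "tval e AZero = 0"
| "tval e (ASuc t) = Suc (tval e t)"
| "tval e (APlus s t) = tval e s + tval e t"
| "tval e (ATimes s t) = tval e s * tval e t"

fun sat :: "(nat \<Rightarrow> nat set) \<Rightarrow> (nat \<Rightarrow> nat) \<Rightarrow> afm \<Rightarrow> bool" where
  "sat S e (AEq s t) = (tval e s = tval e t)"
| "sat S e (AMem j t) = (tval e t \<in> S j)"
| "sat S e (ANot p) = (\<not> sat S e p)"
| "sat S e (AAnd p q) = (sat S e p \<and> sat S e q)"
| "sat S e (AEx p) = (\<exists>n. sat S (\<lambda>i. case i of 0 \<Rightarrow> n | Suc j \<Rightarrow> e j) p)"

definition arith1 :: "(nat set \<Rightarrow> bool) \<Rightarrow> bool" where
  "arith1 P \<longleftrightarrow> (\<exists>\<phi>. \<forall>X. P X \<longleftrightarrow> sat (\<lambda>_. X) (\<lambda>_. 0) \<phi>)"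

definition arith2 :: "(nat set \<Rightarrow> nat set \<Rightarrow> bool) \<Rightarrow> bool" where
  "arith2 P \<longleftrightarrow> (\<exists>\<phi>. \<forall>X Y. P X Y \<longleftrightarrow> sat (\<lambda>j. if j = 0 then X else Y) (\<lambda>_. 0) \<phi>)"

type_synonym principle = "(nat set \<Rightarrow> bool) \<times> (nat set \<Rightarrow> nat set \<Rightarrow> bool)"

definition inst :: "principle \<Rightarrow> nat set \<Rightarrow> bool" where "inst P = fst P"
definition sol :: "principle \<Rightarrow> nat set \<Rightarrow> nat set \<Rightarrow> bool" where "sol P = snd P"

definition is_principle :: "principle \<Rightarrow> bool" where
  "is_principle P \<longleftrightarrow> arith1 (inst P) \<and> arith2 (sol P)"

definition computable :: "nat set \<Rightarrow> bool" where
  "computable X \<longleftrightarrow> turing_le X {}"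

definition bounds :: "nat set \<Rightarrow> principle \<Rightarrow> bool" where
  "bounds D P \<longleftrightarrow> (\<forall>X. inst P X \<and> computable X \<longrightarrow> (\<exists>Y. sol P X Y \<and> turing_le Y D))"

definition admits_universal_instance :: "principle \<Rightarrow> bool" where
  "admits_universal_instance P \<longleftrightarrow>
     (\<exists>U. inst P U \<and> computable U \<and> (\<forall>Y. sol P U Y \<longrightarrow> bounds Y P))"

definition comp_reducible :: "principle \<Rightarrow> principle \<Rightarrow> bool" (infix "\<le>\<^sub>c" 50) where
  "P \<le>\<^sub>c Q \<longleftrightarrow> (\<forall>X. inst P X \<longrightarrow> (\<exists>Y. turing_le Y X \<and> inst Q Y \<and>
      (\<forall>Z. sol Q Y Z \<longrightarrow> (\<exists>W. turing_le W (join Z X) \<and> sol P X W))))"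

definition omega_model :: "principle \<Rightarrow> nat set set \<Rightarrow> bool" where
  "omega_model P M \<longleftrightarrow> M \<noteq> {}
     \<and> (\<forall>A\<in>M. \<forall>B\<in>M. join A B \<in> M)
     \<and> (\<forall>A\<in>M. \<forall>B. turing_le B A \<longrightarrow> B \<in> M)
     \<and> (\<forall>X\<in>M. inst P X \<longrightarrow> (\<exists>Y\<in>M. sol P X Y))"

text \<open>A set codes g : [\<omega>]^2 \<rightarrow> \<omega> as the graph {<<x,s>,g(x,s)> | x < s}.\<close>
definition graph2 :: "(nat \<Rightarrow> nat \<Rightarrow> nat) \<Rightarrow> nat set" where
  "graph2 g = {prod_encode (prod_encode (x, s), g x s) | x s. x < s}"

definition stable2 :: "(nat \<Rightarrow> nat \<Rightarrow> nat) \<Rightarrow> bool" where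
  "stable2 g \<longleftrightarrow> (\<forall>x. \<exists>v N. \<forall>s. N \<le> s \<and> x < s \<longrightarrow> g x s = v)"

definition STS2 :: principle where
  "STS2 = ((\<lambda>X. \<exists>g. X = graph2 g \<and> stable2 g),
           (\<lambda>X A. infinite A \<and> (\<exists>g. X = graph2 g \<and>
               (\<exists>c. \<forall>x\<in>A. \<forall>s\<in>A. x < s \<longrightarrow> g x s \<noteq> c))))"

definition rel_of :: "nat set \<Rightarrow> nat rel" where
  "rel_of X = {(a, b). prod_encode (a, b) \<in> X}"

definition graph1 :: "(nat \<Rightarrow> nat) \<Rightarrow> nat set" where
  "graph1 f = {prod_encode (n, f n) | n. True}"

definition SADS :: principle where
  "SADS = ((\<lambda>X. let R = rel_of X in linear_order_on UNIV R \<and>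
              (\<forall>a. finite {b. (b, a) \<in> R \<and> b \<noteq> a} \<or> finite {b. (a, b) \<in> R \<and> b \<noteq> a})),
           (\<lambda>X Y. let R = rel_of X in \<exists>f. Y = graph1 f \<and>
              ((\<forall>n. (f n, f (Suc n)) \<in> R \<and> f n \<noteq> f (Suc n)) \<or>
               (\<forall>n. (f (Suc n), f n) \<in> R \<and> f n \<noteq> f (Suc n)))))"

end

theory Submission
  imports Defs "HOL-Library.Infinite_Set"
begin

text \<open>A universal instance would have a solution \<open>d\<close> in the \<open>\<omega>\<close>-model, hence a low\<open>\<^sub>2\<close> set bounding the
  principle, so it suffices to find for every low\<open>\<^sub>2\<close> set \<open>d\<close> a computable instance of STS(2), and one
  of SADS, without solution computable in \<open>d\<close>. Both come from a single computable stable colouring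
  \<open>g\<close> such that every infinite set c.e. in \<open>d\<close> has elements of every limit colour. By its own index,
  \<open>g\<close> can refer to the question whether the requirement \<open>(e, a)\<close> is met, i.e. whether \<open>W\<^sub>e\<^sup>d\<close> is finite
  or has an element of limit colour \<open>a\<close>. This question is decidable in \<open>d''\<close>, hence in \<open>\<emptyset>''\<close>, so it
  has a computable approximation by a double limit. The colouring always uses the colour of the least
  requirement that is apparently unmet: if \<open>(e, a)\<close> were really the least unmet one, then almost
  every number would get the limit colour \<open>a\<close>, which meets it. Numbers are coloured in blocks that
  merge whenever the guess changes, which makes the relation \<open>x < s \<and> g x s = 1\<close> orient the
  pairs as a linear order.\<close>

subsection \<open>Closure properties of relative computability\<close>

lemma eval_comp1:
  "eval A g xs y \<Longrightarrow> eval A f [y] v \<Longrightarrow> eval A (Comp f [g]) xs v"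
  by (rule ev_comp[where ys="[y]"]) auto

lemma eval_comp2:
  "eval A g xs y \<Longrightarrow> eval A h xs z \<Longrightarrow> eval A f [y, z] v \<Longrightarrow> eval A (Comp f [g, h]) xs v"
  by (rule ev_comp[where ys="[y, z]"]) (auto simp: less_Suc_eq)

lemma eval_proj0: "eval A (Proj 0) (x # xs) x"
  using ev_proj[of 0 "x # xs" A] by simp

lemma eval_proj1: "eval A (Proj 1) (x # y # xs) y"
  using ev_proj[of 1 "x # y # xs" A] by simp

lemma eval_proj2: "eval A (Proj 2) (x # y # z # xs) z"
  using ev_proj[of 2 "x # y # z # xs" A] by simp

lemma eval_deterministic: "eval A c xs v \<Longrightarrow> eval A c xs w \<Longrightarrow> v = w"
proof (induction arbitrary: w rule: eval.induct)
  case (ev_comp ys gs xs f v)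
  from ev_comp.prems obtain zs where zs: "length zs = length gs"
    "\<forall>i<length gs. eval A (gs ! i) xs (zs ! i)" "eval A f zs w"
    by (cases rule: eval.cases) auto
  have "ys = zs"
    using ev_comp.hyps ev_comp.IH zs by (intro nth_equalityI) auto
  then show ?case using ev_comp.IH zs by auto
next
  case (ev_prec0 f xs v g)
  from ev_prec0.prems show ?case by (cases rule: eval.cases) (auto dest: ev_prec0.IH)
next
  case (ev_precS f g n xs u v)
  from ev_precS.prems show ?case by (cases rule: eval.cases) (auto dest: ev_precS.IH)
next
  case (ev_mu f n xs)
  from ev_mu.prems obtain "eval A f (w # xs) 0" "\<forall>m<w. \<exists>k. eval A f (m # xs) (Suc k)"
    by (cases rule: eval.cases) auto
  then show ?case using ev_mu.IH by (metis linorder_neqE_nat nat.distinct(1))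
qed (auto elim: eval.cases)

definition cf :: "nat set \<Rightarrow> (nat \<Rightarrow> nat) \<Rightarrow> bool" where
  "cf A f \<longleftrightarrow> (\<exists>c. \<forall>n. eval A c [n] (f n))"

definition cf2 :: "nat set \<Rightarrow> (nat \<Rightarrow> nat \<Rightarrow> nat) \<Rightarrow> bool" where
  "cf2 A f \<longleftrightarrow> (\<exists>c. \<forall>m n. eval A c [m, n] (f m n))"

definition dec :: "nat set \<Rightarrow> (nat \<Rightarrow> bool) \<Rightarrow> bool" where
  "dec A P \<longleftrightarrow> cf A (\<lambda>x. of_bool (P x))"

text \<open>Predicates of several arguments are treated as unary predicates of a nested pair,
  decoded by \<open>e1\<close> and \<open>e2\<close>, so that one set of closure rules for
  \<open>cf\<close> and \<open>dec\<close> suffices.\<close>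

definition e1 :: "nat \<Rightarrow> nat" where "e1 n = fst (prod_decode n)"
definition e2 :: "nat \<Rightarrow> nat" where "e2 n = snd (prod_decode n)"

lemma e1_pair [simp]: "e1 (prod_encode (a, b)) = a"
  and e2_pair [simp]: "e2 (prod_encode (a, b)) = b"
  by (simp_all add: e1_def e2_def)

lemma pair_e [simp]: "prod_encode (e1 n, e2 n) = n"
  by (simp add: e1_def e2_def)

lemma ex_pair: "(\<exists>w. P (e1 w) (e2 w)) \<longleftrightarrow> (\<exists>a b. P a b)"
  by (metis e1_pair e2_pair)

lemma e2_le: "e2 n \<le> n"
  by (metis le_prod_encode_2 pair_e)

lemma cf_comp: "cf A f \<Longrightarrow> cf A g \<Longrightarrow> cf A (\<lambda>x. f (g x))"
  unfolding cf_def by (meson eval_comp1)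

lemma cf2_comp: "cf2 A f \<Longrightarrow> cf A g \<Longrightarrow> cf A h \<Longrightarrow> cf A (\<lambda>x. f (g x) (h x))"
  unfolding cf_def cf2_def by (meson eval_comp2)

lemma cf2_comp2: "cf2 A f \<Longrightarrow> cf2 A g \<Longrightarrow> cf2 A h \<Longrightarrow> cf2 A (\<lambda>x y. f (g x y) (h x y))"
  unfolding cf2_def by (meson eval_comp2)

lemma cf_comp_cf2: "cf A f \<Longrightarrow> cf2 A g \<Longrightarrow> cf2 A (\<lambda>x y. f (g x y))"
  unfolding cf_def cf2_def by (meson eval_comp1)

lemma cf2_fst: "cf2 A (\<lambda>x y. x)"
  unfolding cf2_def using eval_proj0 by blast

lemma cf2_snd: "cf2 A (\<lambda>x y. y)"
  unfolding cf2_def using eval_proj1 by blast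

lemma cf_id: "cf A (\<lambda>x. x)"
  unfolding cf_def using eval_proj0 by blast

lemma cf_Suc_base: "cf A Suc"
  unfolding cf_def using ev_succ by blast

lemmas cf_Suc = cf_comp[OF cf_Suc_base]

section \<open>Constants, arithmetic, pairing and unpairing\<close>

fun cst :: "nat \<Rightarrow> rf" where
  "cst 0 = Zero"
| "cst (Suc n) = Comp Succ [cst n]"

lemma eval_cst: "eval A (cst k) xs k"
  by (induction k) (auto intro: ev_zero ev_succ eval_comp1)

lemma cf_const: "cf A (\<lambda>x. k)"
  unfolding cf_def using eval_cst by blast

lemma cf2_add: "cf2 A (+)"
proof -
  have "eval A (Prec (Proj 0) (Comp Succ [Proj 1])) [m, n] (m + n)" for m n
  proof (induction m)
    case 0
    show ?case by (auto intro: ev_prec0 eval_proj0)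
  next
    case (Suc m)
    show ?case
      unfolding add_Suc by (rule ev_precS[OF Suc eval_comp1[OF eval_proj1 ev_succ]])
  qed
  then show ?thesis unfolding cf2_def by blast
qed

lemma cf_pred: "cf A (\<lambda>x. x - 1)"
proof -
  have "eval A (Prec Zero (Proj 0)) [m] (m - 1)" for m
  proof (induction m)
    case 0
    show ?case by (auto intro: ev_prec0 ev_zero)
  next
    case (Suc m)
    show ?case by (simp, rule ev_precS[OF Suc]) (rule eval_proj0)
  qed
  then show ?thesis unfolding cf_def by blast
qed

lemma cf2_diff: "cf2 A (-)"
proof -
  obtain p where p: "eval A p [n] (n - 1)" for n
    using cf_pred unfolding cf_def by blast
  have *: "eval A (Prec (Proj 0) (Comp p [Proj 1])) [m, n] (n - m)" for m n
  proof (induction m)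
    case 0
    show ?case by (auto intro: ev_prec0 eval_proj0)
  next
    case (Suc m)
    have "n - Suc m = (n - m) - 1" by simp
    then show ?case
      by (simp only:) (rule ev_precS[OF Suc], rule eval_comp1[OF eval_proj1 p])
  qed
  have "eval A (Comp (Prec (Proj 0) (Comp p [Proj 1])) [Proj 1, Proj 0]) [m, n] (m - n)" for m n
    by (rule eval_comp2[OF eval_proj1 eval_proj0 *])
  then show ?thesis unfolding cf2_def by blast
qed

lemmas cf_add = cf2_comp[OF cf2_add]
lemmas cf_diff = cf2_comp[OF cf2_diff]

lemma cf_triangle_base: "cf A triangle"
proof -
  obtain p where p: "eval A p [m, n] (m + n)" for m n
    using cf2_add unfolding cf2_def by blast
  have "eval A (Prec Zero (Comp p [Proj 1, Comp Succ [Proj 0]])) [m] (triangle m)" for m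
  proof (induction m)
    case 0
    show ?case by (auto intro: ev_prec0 ev_zero)
  next
    case (Suc m)
    show ?case
      by (simp only: triangle_Suc, rule ev_precS[OF Suc],
          rule eval_comp2[OF eval_proj1 eval_comp1[OF eval_proj0 ev_succ] p])
  qed
  then show ?thesis unfolding cf_def by blast
qed

lemmas cf_triangle = cf_comp[OF cf_triangle_base]

lemma cf2_pair: "cf2 A (\<lambda>x y. prod_encode (x, y))"
  unfolding prod_encode_def prod.case
  by (rule cf2_comp2[OF cf2_add] cf_comp_cf2[OF cf_triangle_base] cf2_fst cf2_snd)+

lemmas cf_pair = cf2_comp[OF cf2_pair]

lemma cf_Least_aux:
  assumes "cf2 A F" and ex: "\<And>x. \<exists>n. F n x = 0"
  shows "cf A (\<lambda>x. LEAST n. F n x = 0)"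
proof -
  obtain p where p: "eval A p [m, n] (F m n)" for m n
    using assms(1) unfolding cf2_def by blast
  have "eval A (Mu p) [x] (LEAST n. F n x = 0)" for x
  proof (rule ev_mu)
    have "F (LEAST n. F n x = 0) x = 0"
      using LeastI_ex[OF ex] .
    then show "eval A p [LEAST n. F n x = 0, x] 0"
      using p by metis
    show "\<forall>m<LEAST n. F n x = 0. \<exists>k. eval A p [m, x] (Suc k)"
      using not_less_Least p by (metis not0_implies_Suc)
  qed
  then show ?thesis unfolding cf_def by blast
qed

text \<open>The truncated difference vanishes iff \<open>n < triangle (Suc k)\<close>. As
  \<open>prod_encode (a, b)\<close> is \<open>triangle (a + b) + a\<close>, the first such
  \<open>k\<close> is \<open>a + b\<close>, from which both coordinates can be read off.\<close>

definition diag :: "nat \<Rightarrow> nat" where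
  "diag n = (LEAST k. Suc n - triangle (Suc k) = 0)"

lemma triangle_ge: "n \<le> triangle n"
  by (induction n) auto

lemma cf_diag: "cf A diag"
  unfolding diag_def
  by (rule cf_Least_aux, (rule cf2_comp2[OF cf2_diff] cf_comp_cf2[OF cf_triangle_base]
        cf_comp_cf2[OF cf_Suc_base] cf2_fst cf2_snd)+)
     (metis diff_is_0_eq triangle_ge)

lemma diag_pair: "diag (prod_encode (a, b)) = a + b"
  unfolding diag_def prod_encode_def
proof (simp only: prod.case, rule Least_equality)
  fix k assume "Suc (triangle (a + b) + a) - triangle (Suc k) = 0"
  moreover have "triangle (Suc k) \<le> triangle (a + b)" if "Suc k \<le> a + b"
    using that by (induction rule: dec_induct) auto
  ultimately show "a + b \<le> k" by fastforce
qed simp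

lemma e1_eq: "e1 n = n - triangle (diag n)" and e2_eq: "e2 n = diag n - e1 n"
proof -
  obtain a b where n: "n = prod_encode (a, b)" by (metis pair_e)
  show "e1 n = n - triangle (diag n)" "e2 n = diag n - e1 n"
    unfolding n diag_pair by (simp_all) (simp add: prod_encode_def)
qed

lemma cf_e1_base: "cf A e1"
  by (subst ext[of e1, OF e1_eq]) (rule cf_diff cf_id cf_triangle cf_diag)+

lemma cf_e2_base: "cf A e2"
  by (subst ext[of e2, OF e2_eq]) (rule cf_diff cf_id cf_e1_base cf_diag)+

lemmas cf_e1 = cf_comp[OF cf_e1_base]
lemmas cf_e2 = cf_comp[OF cf_e2_base]

lemma cf2_of_cf:
  assumes "cf A (\<lambda>p. F (e1 p) (e2 p))"
  shows "cf2 A F"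
  using cf_comp_cf2[OF assms cf2_pair] by simp

lemma dec_of_bool: "dec A P \<Longrightarrow> cf A (\<lambda>x. of_bool (P x))"
  unfolding dec_def .

text \<open>The parameter \<open>x\<close> travels as the last argument of \<open>Prec\<close>, so
  that base and step may depend on it.\<close>

lemma cf_rec:
  assumes f: "cf A f" and g: "cf A (\<lambda>p. G (e1 p) (e1 (e2 p)) (e2 (e2 p)))" and b: "cf A b"
  shows "cf A (\<lambda>x. rec_nat (f x) (\<lambda>n u. G n u x) (b x))"
proof -
  obtain pf where pf: "eval A pf [n] (f n)" for n using f unfolding cf_def by blast
  obtain pg where pg: "eval A pg [n] (G (e1 n) (e1 (e2 n)) (e2 (e2 n)))" for n
    using g unfolding cf_def by blast
  obtain pp where pp: "eval A pp [m, n] (prod_encode (m, n))" for m n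
    using cf2_pair unfolding cf2_def by blast
  let ?q = "Comp pg [Comp pp [Proj 0, Comp pp [Proj 1, Proj 2]]]"
  have q: "eval A ?q [n, u, x] (G n u x)" for n u x
    by (rule eval_comp1[OF eval_comp2[OF eval_proj0 eval_comp2[OF eval_proj1 eval_proj2 pp] pp]])
       (use pg[of "prod_encode (n, prod_encode (u, x))"] in simp)
  have "eval A (Prec pf ?q) [n, x] (rec_nat (f x) (\<lambda>n u. G n u x) n)" for n x
    by (induction n) (simp_all del: One_nat_def, rule ev_prec0[OF pf], rule ev_precS[OF _ q])
  then have "cf2 A (\<lambda>n x. rec_nat (f x) (\<lambda>n u. G n u x) n)"
    unfolding cf2_def by blast
  from cf2_comp[OF this b cf_id] show ?thesis .
qed

lemma cf_if:
  assumes "dec A P" "cf A f" "cf A g"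
  shows "cf A (\<lambda>x. if P x then f x else g x)"
proof -
  \<comment> \<open>Zero rounds of the recursion return \<open>g x\<close>, one round returns
    \<open>f x\<close>.\<close>
  have "cf A (\<lambda>x. rec_nat (g x) (\<lambda>n u. f x) (of_bool (P x)))"
    by (rule cf_rec) (intro assms cf_comp[OF assms(2)] cf_e1 cf_e2 cf_id dec_of_bool)+
  moreover have "rec_nat (g x) (\<lambda>n u. f x) (of_bool (P x)) = (if P x then f x else g x)" for x
    by simp
  ultimately show ?thesis by simp
qed

section \<open>Decidable predicates, least witnesses and bounded quantifiers\<close>

lemma dec_comp: "dec A P \<Longrightarrow> cf A f \<Longrightarrow> dec A (\<lambda>x. P (f x))"
  unfolding dec_def by (rule cf_comp)

lemma dec_not:
  assumes "dec A P"
  shows "dec A (\<lambda>x. \<not> P x)"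
proof -
  have "cf A (\<lambda>x. 1 - of_bool (P x))"
    by (intro cf_diff cf_const dec_of_bool assms)
  moreover have "1 - of_bool (P x) = (of_bool (\<not> P x) :: nat)" for x by simp
  ultimately show ?thesis unfolding dec_def by simp
qed

lemma dec_less:
  assumes "cf A f" "cf A g"
  shows "dec A (\<lambda>x. f x < g x)"
proof -
  have "cf A (\<lambda>x. 1 - (1 - (g x - f x)))"
    by (intro cf_diff cf_const assms)
  moreover have "1 - (1 - (g x - f x)) = of_bool (f x < g x)" for x by auto
  ultimately show ?thesis unfolding dec_def by simp
qed

lemma dec_or:
  assumes "dec A P" "dec A Q"
  shows "dec A (\<lambda>x. P x \<or> Q x)"
proof -
  have "dec A (\<lambda>x. 0 < of_bool (P x) + (of_bool (Q x) :: nat))"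
    by (intro dec_less cf_add cf_const dec_of_bool assms)
  moreover have "0 < of_bool (P x) + (of_bool (Q x) :: nat) \<longleftrightarrow> P x \<or> Q x" for x by simp
  ultimately show ?thesis by simp
qed

lemma dec_and:
  assumes "dec A P" "dec A Q"
  shows "dec A (\<lambda>x. P x \<and> Q x)"
  using dec_not[OF dec_or[OF dec_not[OF assms(1)] dec_not[OF assms(2)]]] by simp

lemma dec_le:
  assumes "cf A f" "cf A g"
  shows "dec A (\<lambda>x. f x \<le> g x)"
  using dec_not[OF dec_less[OF assms(2,1)]] by (simp add: not_less)

lemma dec_eq:
  assumes "cf A f" "cf A g"
  shows "dec A (\<lambda>x. f x = g x)"
  using dec_and[OF dec_le[OF assms] dec_le[OF assms(2,1)]] by (simp add: eq_iff)

lemma dec_const: "dec A (\<lambda>x. b)"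
  unfolding dec_def by (rule cf_const)

lemma cf_Least:
  assumes P: "dec A (\<lambda>p. P (e1 p) (e2 p))" and ex: "\<And>x. \<exists>n. P x n"
  shows "cf A (\<lambda>x. LEAST n. P x n)"
proof -
  \<comment> \<open>\<open>Mu\<close> searches for a zero and puts the search variable first, hence
    the negation and the swapped pair.\<close>
  have "dec A (\<lambda>q. \<not> P (e1 (prod_encode (e2 q, e1 q))) (e2 (prod_encode (e2 q, e1 q))))"
    by (intro dec_not dec_comp[OF P] cf_pair cf_e1 cf_e2 cf_id)
  then have "cf2 A (\<lambda>n x. of_bool (\<not> P x n))"
    by (intro cf2_of_cf dec_of_bool) simp
  then have "cf A (\<lambda>x. LEAST n. of_bool (\<not> P x n) = (0::nat))"
    by (rule cf_Least_aux) (use ex in auto)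
  then show ?thesis by simp
qed

text \<open>A search that stops at \<open>b x\<close> at the latest ends strictly below
  \<open>b x\<close> exactly if it has found a witness.\<close>

lemma dec_bex:
  assumes P: "dec A (\<lambda>p. P (e1 p) (e2 p))" and b: "cf A b"
  shows "dec A (\<lambda>x. \<exists>m<b x. P x m)"
proof -
  have "cf A (\<lambda>x. LEAST m. b x \<le> m \<or> P x m)"
    by (rule cf_Least) (intro dec_or P dec_le cf_comp[OF b] cf_e1 cf_e2 cf_id, auto)
  then have "dec A (\<lambda>x. (LEAST m. b x \<le> m \<or> P x m) < b x)"
    using b by (rule dec_less)
  moreover have "(LEAST m. b x \<le> m \<or> P x m) < b x \<longleftrightarrow> (\<exists>m<b x. P x m)" for x
    by (metis (mono_tags, lifting) LeastI Least_le leD leI order_le_less_trans)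
  ultimately show ?thesis by simp
qed

lemma dec_ball:
  assumes P: "dec A (\<lambda>p. P (e1 p) (e2 p))" and b: "cf A b"
  shows "dec A (\<lambda>x. \<forall>m<b x. P x m)"
  using dec_not[OF dec_bex[OF dec_not[OF P] b]] by simp

lemmas cf_intros = cf_const cf_id cf_Suc cf_add cf_diff cf_pair cf_e1 cf_e2 cf_if
  dec_of_bool dec_const dec_not dec_or dec_and dec_less dec_le dec_eq dec_bex dec_ball

section \<open>Turing reducibility: oracle substitution, transitivity and joins\<close>

lemma turing_le_iff_dec: "turing_le B A \<longleftrightarrow> dec A (\<lambda>n. n \<in> B)"
  unfolding turing_le_def dec_def cf_def of_bool_def by simp

lemma dec_oracle: "dec A (\<lambda>x. x \<in> A)"
  unfolding turing_le_iff_dec[symmetric] turing_le_def using ev_orc by blast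

text \<open>\<open>Oracle\<close> reads only the head of its argument list, hence the projection
  before \<open>p\<close>.\<close>

fun subst_oracle :: "rf \<Rightarrow> rf \<Rightarrow> rf" where
  "subst_oracle p Oracle = Comp p [Proj 0]"
| "subst_oracle p (Comp f gs) = Comp (subst_oracle p f) (map (subst_oracle p) gs)"
| "subst_oracle p (Prec f g) = Prec (subst_oracle p f) (subst_oracle p g)"
| "subst_oracle p (Mu f) = Mu (subst_oracle p f)"
| "subst_oracle p c = c"

lemma eval_subst_oracle:
  assumes p: "\<And>n. eval A p [n] (if n \<in> B then 1 else 0)"
  shows "eval B c xs v \<Longrightarrow> eval A (subst_oracle p c) xs v"
proof (induction rule: eval.induct)
  case (ev_orc x xs)
  show ?case unfolding subst_oracle.simps by (rule eval_comp1[OF eval_proj0 p])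
next
  case (ev_comp ys gs xs f v)
  then show ?case unfolding subst_oracle.simps by (intro eval.ev_comp[where ys=ys]) auto
next
  case (ev_mu f n xs)
  then show ?case unfolding subst_oracle.simps by (intro eval.ev_mu) blast+
qed (auto intro: eval.intros)

lemma cf_trans: "cf B f \<Longrightarrow> turing_le B A \<Longrightarrow> cf A f"
  unfolding cf_def turing_le_def by (meson eval_subst_oracle)

lemma dec_trans: "dec B P \<Longrightarrow> turing_le B A \<Longrightarrow> dec A P"
  unfolding dec_def by (rule cf_trans)

lemma turing_le_trans: "turing_le C B \<Longrightarrow> turing_le B A \<Longrightarrow> turing_le C A"
  unfolding turing_le_iff_dec[of C] by (rule dec_trans)

lemma turing_le_empty: "turing_le {} A"
  unfolding turing_le_iff_dec by (simp add: dec_const)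

lemma turing_le_join:
  "turing_le (join X Y) A" if X: "turing_le X A" and Y: "turing_le Y A"
proof -
  \<comment> \<open>Half of \<open>x\<close>, rounded up: an odd \<open>2 * n + 1\<close> yields
    \<open>Suc n\<close>, which accounts for the \<open>- 1\<close> below.\<close>
  have half: "cf A (\<lambda>x. LEAST n. x \<le> n + n)"
    by (rule cf_Least) (intro cf_intros, metis trans_le_add1 le_refl)
  let ?h = "\<lambda>x. LEAST n. x \<le> n + n"
  have h: "?h (2 * n) = n" "?h (2 * n + 1) = Suc n" for n
    by (rule Least_equality; simp)+
  have "dec A (\<lambda>x. (x = ?h x + ?h x \<and> ?h x \<in> X) \<or>
      (Suc x = ?h x + ?h x \<and> ?h x - 1 \<in> Y))"
    by (intro cf_intros half dec_comp[OF X[unfolded turing_le_iff_dec]]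
        dec_comp[OF Y[unfolded turing_le_iff_dec]])
  moreover have "(x = ?h x + ?h x \<and> ?h x \<in> X) \<or> (Suc x = ?h x + ?h x \<and> ?h x - 1 \<in> Y)
      \<longleftrightarrow> x \<in> join X Y" for x
  proof (cases "even x")
    case True
    then obtain n where n: "x = 2 * n" by blast
    have "x \<in> join X Y \<longleftrightarrow> n \<in> X" unfolding n join_def by (auto; presburger)
    then show ?thesis unfolding n h by auto
  next
    case False
    then obtain n where n: "x = 2 * n + 1" using oddE by blast
    have "x \<in> join X Y \<longleftrightarrow> n \<in> Y" unfolding n join_def by (auto; presburger)
    then show ?thesis unfolding n h by auto
  qed
  ultimately show ?thesis unfolding turing_le_iff_dec by simp
qed


subsection \<open>Stagewise enumeration of computations\<close>

lemma cf_lift2: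
  "cf A (\<lambda>p. F (e1 p) (e2 p)) \<Longrightarrow> cf A f \<Longrightarrow> cf A g \<Longrightarrow> cf A (\<lambda>x. F (f x) (g x))"
  by (rule cf2_comp[OF cf2_of_cf])

lemma dec_lift2:
  "dec A (\<lambda>p. P (e1 p) (e2 p)) \<Longrightarrow> cf A f \<Longrightarrow> cf A g \<Longrightarrow> dec A (\<lambda>x. P (f x) (g x))"
  unfolding dec_def by (rule cf_lift2)

lemma dec_lift3:
  assumes "dec A (\<lambda>p. P (e1 p) (e1 (e2 p)) (e2 (e2 p)))" "cf A f" "cf A g" "cf A h"
  shows "dec A (\<lambda>x. P (f x) (g x) (h x))"
  using dec_comp[OF assms(1), of "\<lambda>x. prod_encode (f x, prod_encode (g x, h x))"] assms(2-4)
  by (simp add: cf_pair)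

section \<open>Computable operations on coded lists\<close>

definition lcons :: "nat \<Rightarrow> nat \<Rightarrow> nat" where "lcons x n = Suc (prod_encode (x, n))"
definition lhd :: "nat \<Rightarrow> nat" where "lhd n = e1 (n - 1)"
definition ltl :: "nat \<Rightarrow> nat" where "ltl n = e2 (n - 1)"
definition ldrop :: "nat \<Rightarrow> nat \<Rightarrow> nat" where "ldrop n i = rec_nat n (\<lambda>_ u. ltl u) i"
definition lnth :: "nat \<Rightarrow> nat \<Rightarrow> nat" where "lnth n i = lhd (ldrop n i)"
definition llen :: "nat \<Rightarrow> nat" where "llen n = (LEAST i. ldrop n i = 0)"
definition lmem :: "nat \<Rightarrow> nat \<Rightarrow> bool" where "lmem x n \<longleftrightarrow> (\<exists>i<llen n. lnth n i = x)"

lemma lcons_encode [simp]: "lcons x (list_encode xs) = list_encode (x # xs)"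
  by (simp add: lcons_def)

lemma lhd_encode [simp]: "lhd (list_encode (x # xs)) = x"
  by (simp add: lhd_def)

text \<open>Makes \<open>ltl\<close> fix 0, the code of the empty list, so that dropping past the
  end is harmless.\<close>

lemma e2_0 [simp]: "e2 0 = 0"
  using e2_le[of 0] by simp

lemma ltl_encode [simp]: "ltl (list_encode xs) = list_encode (tl xs)"
  by (cases xs) (simp_all add: ltl_def)

lemma ldrop_encode: "ldrop (list_encode xs) i = list_encode (drop i xs)"
  unfolding ldrop_def by (induction i) (simp_all add: drop_Suc tl_drop)

lemma lnth_encode [simp]: "i < length xs \<Longrightarrow> lnth (list_encode xs) i = xs ! i"
  by (simp add: lnth_def ldrop_encode Cons_nth_drop_Suc[symmetric] del: list_encode.simps)

lemma list_encode_eq_0 [simp]: "list_encode xs = 0 \<longleftrightarrow> xs = []"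
  by (cases xs) auto

lemma llen_encode [simp]: "llen (list_encode xs) = length xs"
  unfolding llen_def ldrop_encode by (rule Least_equality) auto

lemma llen_0 [simp]: "llen 0 = 0"
  using llen_encode[of "[]"] by simp

lemma lmem_encode [simp]: "lmem x (list_encode xs) \<longleftrightarrow> x \<in> set xs"
  unfolding lmem_def by (auto simp: in_set_conv_nth)

lemma list_encode_cases: obtains xs where "n = list_encode xs"
  by (metis list_decode_inverse)

lemma lmem_lcons [simp]: "lmem x (lcons y n) \<longleftrightarrow> x = y \<or> lmem x n"
  by (cases n rule: list_encode_cases) (simp del: list_encode.simps)

lemma lmem_0 [simp]: "\<not> lmem x 0"
  using lmem_encode[of x "[]"] by simp

text \<open>Each pairing in a list code dominates its components. This is why the quantifiers
  bounded by \<open>D\<close> in \<open>rule_step\<close> lose no witness.\<close>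

lemma lmem_less: "lmem x n \<Longrightarrow> x < n"
proof (cases n rule: list_encode_cases)
  case (1 xs)
  have "x \<in> set xs \<Longrightarrow> x < list_encode xs"
  proof (induction xs)
    case (Cons y xs)
    then show ?case
      using le_prod_encode_1[of y "list_encode xs"] le_prod_encode_2[of "list_encode xs" y] by auto
  qed simp
  then show "lmem x n \<Longrightarrow> x < n" unfolding 1 by simp
qed

lemma cf_lcons: "cf A f \<Longrightarrow> cf A g \<Longrightarrow> cf A (\<lambda>x. lcons (f x) (g x))"
  unfolding lcons_def by (intro cf_intros)

lemma cf_lhd: "cf A f \<Longrightarrow> cf A (\<lambda>x. lhd (f x))"
  unfolding lhd_def by (intro cf_intros)

lemma cf_ltl: "cf A f \<Longrightarrow> cf A (\<lambda>x. ltl (f x))"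
  unfolding ltl_def by (intro cf_intros)

lemma cf_ldrop: "cf A f \<Longrightarrow> cf A g \<Longrightarrow> cf A (\<lambda>x. ldrop (f x) (g x))"
  unfolding ldrop_def by (rule cf_rec) (assumption | intro cf_intros cf_ltl)+

lemma cf_lnth: "cf A f \<Longrightarrow> cf A g \<Longrightarrow> cf A (\<lambda>x. lnth (f x) (g x))"
  unfolding lnth_def by (intro cf_lhd cf_ldrop)

lemma ldrop_self: "\<exists>i. ldrop n i = 0"
  by (cases n rule: list_encode_cases) (auto simp: ldrop_encode)

lemma cf_llen: "cf A f \<Longrightarrow> cf A (\<lambda>x. llen (f x))"
  by (rule cf_comp[of A llen])
     (unfold llen_def, rule cf_Least, (intro cf_intros cf_ldrop), rule ldrop_self)

lemma dec_lmem: "cf A f \<Longrightarrow> cf A g \<Longrightarrow> dec A (\<lambda>x. lmem (f x) (g x))"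
  by (rule dec_lift2[of A lmem]) (unfold lmem_def, intro cf_intros cf_llen cf_lnth)

lemmas cfl_intros = cf_intros cf_lcons cf_lhd cf_ltl cf_lnth cf_llen dec_lmem

text \<open>Since \<open>e1\<close> takes every value infinitely often, a fact that becomes derivable is added later.\<close>

definition stage :: "(nat \<Rightarrow> nat \<Rightarrow> bool) \<Rightarrow> nat \<Rightarrow> nat" where
  "stage step s = rec_nat 0 (\<lambda>n D. if step D (e1 n) then lcons (e1 n) D else D) s"

lemma stage_0 [simp]: "stage step 0 = 0"
  by (simp add: stage_def)

lemma stage_Suc:
  "stage step (Suc s) =
    (if step (stage step s) (e1 s) then lcons (e1 s) (stage step s) else stage step s)"
  by (simp add: stage_def)

lemma cf_stage:
  assumes S: "dec A (\<lambda>p. S (e1 p) (e1 (e2 p)) (e2 (e2 p)))" and f: "cf A f"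
  shows "cf A (\<lambda>x. stage (S x) (f x))"
  unfolding stage_def
  by (rule cf_rec) (intro cfl_intros dec_lift3[OF S] f)+

lemma stage_mono: "lmem x (stage step s) \<Longrightarrow> s \<le> t \<Longrightarrow> lmem x (stage step t)"
  by (rotate_tac, induction rule: dec_induct) (simp_all add: stage_Suc)

text \<open>Stage \<open>prod_encode (f, s0)\<close> offers exactly \<open>f\<close> and comes no
  earlier than \<open>s0\<close>.\<close>

lemma stage_intro:
  assumes "\<And>s. s \<ge> s0 \<Longrightarrow> step (stage step s) f"
  shows "\<exists>s. lmem f (stage step s)"
proof
  show "lmem f (stage step (Suc (prod_encode (f, s0))))"
    using assms[OF le_prod_encode_2] by (simp add: stage_Suc)
qed

text \<open>Every entry is justified by a strictly earlier stage, which allows soundness proofs by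
  strong induction on the stage.\<close>

lemma stage_elim:
  assumes "lmem f (stage step s)"
  obtains t where "t < s" "step (stage step t) f"
  using assms
proof (induction s arbitrary: thesis)
  case (Suc s)
  then show ?case by (auto simp: stage_Suc less_Suc_eq split: if_splits)
qed simp

section \<open>Recognising program codes\<close>

definition code_step :: "nat \<Rightarrow> nat \<Rightarrow> bool" where
  "code_step D c \<longleftrightarrow> e1 c = 0 \<and> e2 c = 0 \<or> e1 c = 1 \<and> e2 c = 0 \<or> e1 c = 2 \<or> e1 c = 3 \<and> e2 c = 0
    \<or> e1 c = 4 \<and> lmem (e1 (e2 c)) D \<and> (\<forall>i<llen (e2 (e2 c)). lmem (lnth (e2 (e2 c)) i) D)
    \<or> e1 c = 5 \<and> lmem (e1 (e2 c)) D \<and> lmem (e2 (e2 c)) D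
    \<or> e1 c = 6 \<and> lmem (e2 c) D"

lemma enc_list:
  assumes "\<forall>i<length xs. xs ! i \<in> range enc"
  shows "\<exists>gs. xs = map enc gs"
proof -
  have "\<forall>x\<in>set xs. \<exists>g. x = enc g" using assms by (metis in_set_conv_nth imageE)
  then show ?thesis using ex_map_conv[of xs enc] by blast
qed

lemma code_sound: "lmem n (stage code_step s) \<Longrightarrow> n \<in> range enc"
proof (induction s arbitrary: n rule: less_induct)
  case (less s)
  from less.prems obtain t where t: "t < s" "code_step (stage code_step t) n"
    by (rule stage_elim)
  define D where "D = stage code_step t"
  note IH = less.IH[OF t(1), folded D_def]
  define a where "a = e2 n"
  have n: "n = prod_encode (e1 n, a)" by (simp add: a_def)
  obtain gs where gs: "e2 a = list_encode gs" by (rule list_encode_cases)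
  from t(2)[folded D_def] consider "e1 n = 0" "a = 0" | "e1 n = 1" "a = 0" | "e1 n = 2" | "e1 n = 3" "a = 0"
    | "e1 n = 4" "e1 a \<in> range enc" "\<forall>i<length gs. gs ! i \<in> range enc"
    | "e1 n = 5" "e1 a \<in> range enc" "e2 a \<in> range enc"
    | "e1 n = 6" "a \<in> range enc"
    unfolding code_step_def a_def[symmetric] gs using IH by auto
  then show ?case
  proof cases
    case 1 then have "n = enc Zero" using n by simp then show ?thesis by blast
  next
    case 2 then have "n = enc Succ" using n by simp then show ?thesis by blast
  next
    case 3 then have "n = enc (Proj a)" using n by simp then show ?thesis by blast
  next
    case 4 then have "n = enc Oracle" using n by simp then show ?thesis by blast
  next
    case 5
    then obtain f hs where "e1 a = enc f" "gs = map enc hs" using enc_list by blast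
    then have "n = enc (Comp f hs)" using n 5 gs pair_e[of a] by simp
    then show ?thesis by blast
  next
    case 6
    then obtain f g where "e1 a = enc f" "e2 a = enc g" by blast
    then have "n = enc (Prec f g)" using n 6 pair_e[of a] by simp
    then show ?thesis by blast
  next
    case 7
    then obtain f where "a = enc f" by blast
    then have "n = enc (Mu f)" using n 7 by simp
    then show ?thesis by blast
  qed
qed

text \<open>The sum of the individual stages is a common one, because the enumeration only
  grows.\<close>

lemma uniform_stage:
  fixes n :: nat
  assumes "\<forall>i<n. \<exists>s. lmem (x i) (stage step s)"
  shows "\<exists>s0. \<forall>s\<ge>s0. \<forall>i<n. lmem (x i) (stage step s)"
proof -
  from assms obtain S where S: "\<forall>i<n. lmem (x i) (stage step (S i))" by metis
  have "S i \<le> (\<Sum>i<n. S i)" if "i < n" for i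
    using that by (intro member_le_sum) auto
  then show ?thesis using S by (meson le_trans stage_mono)
qed

lemma code_complete: "\<exists>s. lmem (enc c) (stage code_step s)"
proof (induction c)
  case (Comp f gs)
  then obtain s1 where s1: "lmem (enc f) (stage code_step s1)" by blast
  have "\<forall>i<length gs. \<exists>s. lmem (enc (gs ! i)) (stage code_step s)" using Comp by simp
  then obtain s2 where "\<forall>s\<ge>s2. \<forall>i<length gs. lmem (enc (gs ! i)) (stage code_step s)"
    using uniform_stage[where x="\<lambda>i. enc (gs ! i)"] by blast
  then show ?case
    by (intro stage_intro[of "max s1 s2"], subst code_step_def) (auto intro: stage_mono[OF s1])
next
  case (Prec f g)
  then obtain s1 s2 where s: "lmem (enc f) (stage code_step s1)" "lmem (enc g) (stage code_step s2)"
    by blast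
  then show ?case
    by (intro stage_intro[of "max s1 s2"], subst code_step_def) (auto intro: stage_mono)
next
  case (Mu f)
  then obtain s1 where s: "lmem (enc f) (stage code_step s1)" by blast
  then show ?case
    by (intro stage_intro[of s1], subst code_step_def) (auto intro: stage_mono)
qed (rule stage_intro, subst code_step_def, simp)+

lemma cf_code_stage: "cf A f \<Longrightarrow> cf A (\<lambda>x. stage code_step (f x))"
  by (rule cf_stage[where S="\<lambda>_. code_step"]) (unfold code_step_def, (intro cfl_intros)+)

section \<open>Enumerating computations relative to an oracle\<close>

definition fact :: "nat \<Rightarrow> nat \<Rightarrow> nat \<Rightarrow> nat" where
  "fact c xs v = prod_encode (c, prod_encode (xs, v))"

text \<open>\<open>fact c xs v\<close> stands for program \<open>c\<close> returning
  \<open>v\<close> on the coded list \<open>xs\<close>. With \<open>t\<close> and \<open>a\<close>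
  the two halves of the program code, the clauses transcribe the rules of \<open>eval\<close>, whose
  premises are looked up in the list \<open>D\<close> of facts already found. All quantifiers are
  bounded to keep the step decidable.\<close>

definition rule_step :: "(nat \<Rightarrow> bool) \<Rightarrow> nat \<Rightarrow> nat \<Rightarrow> nat \<Rightarrow> nat \<Rightarrow> nat \<Rightarrow> bool" where
  "rule_step Q D t a xs v \<longleftrightarrow>
     t = 0 \<and> v = 0
   \<or> t = 1 \<and> 0 < llen xs \<and> v = Suc (lhd xs)
   \<or> t = 2 \<and> a < llen xs \<and> v = lnth xs a
   \<or> t = 3 \<and> 0 < llen xs \<and> v = of_bool (Q (lhd xs))
   \<or> t = 4 \<and> (\<exists>ys<D. llen ys = llen (e2 a)
        \<and> (\<forall>i<llen (e2 a). lmem (fact (lnth (e2 a) i) xs (lnth ys i)) D) \<and> lmem (fact (e1 a) ys v) D)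
   \<or> t = 5 \<and> 0 < llen xs \<and> (lhd xs = 0 \<and> lmem (fact (e1 a) (ltl xs) v) D
        \<or> 0 < lhd xs \<and> (\<exists>u<D. lmem (fact (prod_encode (5, a)) (lcons (lhd xs - 1) (ltl xs)) u) D
            \<and> lmem (fact (e2 a) (lcons (lhd xs - 1) (lcons u (ltl xs))) v) D))
   \<or> t = 6 \<and> lmem (fact a (lcons v xs) 0) D
        \<and> (\<forall>m<v. \<exists>k<D. lmem (fact a (lcons m xs) (Suc k)) D)"

definition eval_step :: "(nat \<Rightarrow> bool) \<Rightarrow> nat \<Rightarrow> nat \<Rightarrow> bool" where
  "eval_step Q D f = rule_step Q D (e1 (e1 f)) (e2 (e1 f)) (e1 (e2 f)) (e2 (e2 f))"

definition comps :: "(nat \<Rightarrow> bool) \<Rightarrow> nat \<Rightarrow> nat" where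
  "comps Q s = stage (eval_step Q) s"

lemma cf_fact: "cf A f \<Longrightarrow> cf A g \<Longrightarrow> cf A h \<Longrightarrow> cf A (\<lambda>x. fact (f x) (g x) (h x))"
  unfolding fact_def by (intro cf_intros)

text \<open>The oracle may depend on the input \<open>x\<close>; this makes it possible to compute
  relative to a changing approximation of a jump.\<close>

lemma cf_comps:
  assumes Q: "dec A (\<lambda>p. Q (e1 p) (e2 p))" and f: "cf A f"
  shows "cf A (\<lambda>x. comps (Q x) (f x))"
  unfolding comps_def
  by (rule cf_stage[where S="\<lambda>x. eval_step (Q x)", OF _ f])
     (unfold eval_step_def rule_step_def, (intro cfl_intros cf_fact dec_lift2[OF Q])+)

lemma fact_less: "lmem (fact c xs v) D \<Longrightarrow> xs < D \<and> v < D"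
  unfolding fact_def
  by (meson lmem_less le_prod_encode_1 le_prod_encode_2 le_less_trans)

text \<open>A new fact rests only on facts of an earlier stage, so strong induction on the stage
  turns its clause into the matching rule of \<open>eval\<close>.\<close>

lemma comps_sound:
  "lmem (fact (enc c) (list_encode xs) v) (comps (\<lambda>x. x \<in> A) s) \<Longrightarrow> eval A c xs v"
proof (induction s arbitrary: c xs v rule: less_induct)
  case (less s)
  from less.prems[unfolded comps_def]
  obtain t where t: "t < s"
    "eval_step (\<lambda>x. x \<in> A) (comps (\<lambda>x. x \<in> A) t) (fact (enc c) (list_encode xs) v)"
    unfolding comps_def by (rule stage_elim)
  define D where "D = comps (\<lambda>x. x \<in> A) t"
  note IH = less.IH[OF t(1), folded D_def]
  have step: "rule_step (\<lambda>x. x \<in> A) D (e1 (enc c)) (e2 (enc c)) (list_encode xs) v"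
    using t(2) unfolding D_def eval_step_def fact_def by simp
  show ?case
  proof (cases c)
    case Zero
    then show ?thesis using step by (auto simp: rule_step_def intro: ev_zero)
  next
    case Succ
    then show ?thesis using step
      by (cases xs) (auto simp: rule_step_def simp del: list_encode.simps intro: ev_succ)
  next
    case (Proj i)
    then show ?thesis using step by (auto simp: rule_step_def intro: ev_proj)
  next
    case Oracle
    then show ?thesis using step ev_orc[of A "hd xs" "tl xs"]
      by (cases xs) (auto simp: rule_step_def of_bool_def simp del: list_encode.simps)
  next
    case (Comp f gs)
    obtain ys where ys: "llen ys = length gs" "lmem (fact (enc f) ys v) D"
      "\<forall>i<length gs. lmem (fact (enc (gs ! i)) (list_encode xs) (lnth ys i)) D"
      using step Comp by (auto simp: rule_step_def)
    obtain zs where zs: "ys = list_encode zs" by (rule list_encode_cases)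
    show ?thesis unfolding Comp
      by (rule ev_comp[where ys=zs]) (use ys IH in \<open>auto simp: zs\<close>)
  next
    case (Prec f g)
    then obtain n xs' where xs: "xs = n # xs'" using step by (cases xs) (auto simp: rule_step_def)
    show ?thesis
    proof (cases n)
      case 0
      then show ?thesis using step Prec IH
        by (auto simp: rule_step_def xs simp del: list_encode.simps intro: ev_prec0)
    next
      case (Suc m)
      then obtain u where
        "lmem (fact (enc (Prec f g)) (list_encode (m # xs')) u) D"
        "lmem (fact (enc g) (list_encode (m # u # xs')) v) D"
        using step Prec by (auto simp: rule_step_def xs simp del: list_encode.simps)
      then show ?thesis unfolding Prec xs Suc by (intro ev_precS IH)
    qed
  next
    case (Mu f)
    then show ?thesis using step IH
      by (auto simp: rule_step_def simp del: list_encode.simps intro!: ev_mu) blast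
  qed
qed

lemma comps_mono: "lmem x (comps Q s) \<Longrightarrow> s \<le> t \<Longrightarrow> lmem x (comps Q t)"
  unfolding comps_def by (rule stage_mono)

lemma comps_intro:
  assumes "\<And>s. s \<ge> s0 \<Longrightarrow> rule_step Q (comps Q s) (e1 c) (e2 c) xs v"
  shows "\<exists>s. lmem (fact c xs v) (comps Q s)"
  unfolding comps_def
  by (rule stage_intro) (use assms in \<open>simp add: eval_step_def fact_def comps_def\<close>)

text \<open>Induction on the evaluation: each rule has finitely many premises, so all of them are
  present from some common stage on.\<close>

lemma comps_complete:
  "eval A c xs v \<Longrightarrow> \<exists>s. lmem (fact (enc c) (list_encode xs) v) (comps (\<lambda>x. x \<in> A) s)"
proof (induction rule: eval.induct)
  case (ev_comp ys gs xs f v)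
  let ?Q = "\<lambda>x. x \<in> A"
  from ev_comp obtain s1 where s1: "lmem (fact (enc f) (list_encode ys) v) (comps ?Q s1)" by blast
  from ev_comp uniform_stage[of "length gs" "\<lambda>i. fact (enc (gs ! i)) (list_encode xs) (ys ! i)"]
  obtain s2 where s2: "\<forall>s\<ge>s2. \<forall>i<length gs.
      lmem (fact (enc (gs ! i)) (list_encode xs) (ys ! i)) (comps ?Q s)"
    unfolding comps_def by blast
  show ?case
  proof (rule comps_intro[of "max s1 s2"])
    fix s assume s: "max s1 s2 \<le> s"
    then have "lmem (fact (enc f) (list_encode ys) v) (comps ?Q s)"
      using s1 comps_mono by (meson max.boundedE)
    \<comment> \<open>This bound admits \<open>list_encode ys\<close> as the witness required by the
      clause for \<open>Comp\<close>.\<close>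
    moreover from this have "list_encode ys < comps ?Q s" using fact_less by blast
    ultimately show "rule_step ?Q (comps ?Q s) (e1 (enc (Comp f gs))) (e2 (enc (Comp f gs))) (list_encode xs) v"
      using s s2 ev_comp.hyps(1) by (simp add: rule_step_def) (rule exI[of _ "list_encode ys"], simp)
  qed
next
  case (ev_prec0 f xs v g)
  then obtain s0 where s0: "lmem (fact (enc f) (list_encode xs) v) (comps (\<lambda>x. x \<in> A) s0)" by blast
  show ?case
    by (rule comps_intro[of s0])
       (use comps_mono[OF s0] in \<open>auto simp: rule_step_def simp del: list_encode.simps\<close>)
next
  case (ev_precS f g n xs u v)
  let ?Q = "\<lambda>x. x \<in> A"
  from ev_precS obtain s1 s2 where
    s1: "lmem (fact (enc (Prec f g)) (list_encode (n # xs)) u) (comps ?Q s1)" and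
    s2: "lmem (fact (enc g) (list_encode (n # u # xs)) v) (comps ?Q s2)" by blast
  show ?case
  proof (rule comps_intro[of "max s1 s2"])
    fix s assume s: "max s1 s2 \<le> s"
    then have "lmem (fact (enc (Prec f g)) (list_encode (n # xs)) u) (comps ?Q s)"
      "lmem (fact (enc g) (list_encode (n # u # xs)) v) (comps ?Q s)"
      using s1 s2 comps_mono by (meson max.boundedE)+
    moreover from this have "u < comps ?Q s" using fact_less by blast
    ultimately show "rule_step ?Q (comps ?Q s) (e1 (enc (Prec f g))) (e2 (enc (Prec f g)))
        (list_encode (Suc n # xs)) v"
      by (auto simp: rule_step_def simp del: list_encode.simps)
  qed
next
  case (ev_mu f n xs)
  let ?Q = "\<lambda>x. x \<in> A"
  from ev_mu obtain s1 where s1: "lmem (fact (enc f) (list_encode (n # xs)) 0) (comps ?Q s1)" by blast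
  from ev_mu obtain k where k:
    "\<forall>m<n. \<exists>s. lmem (fact (enc f) (list_encode (m # xs)) (Suc (k m))) (comps ?Q s)" by metis
  from uniform_stage[OF this[unfolded comps_def]] obtain s2 where s2: "\<forall>s\<ge>s2. \<forall>m<n.
      lmem (fact (enc f) (list_encode (m # xs)) (Suc (k m))) (comps ?Q s)"
    unfolding comps_def by blast
  show ?case
  proof (rule comps_intro[of "max s1 s2"])
    fix s assume s: "max s1 s2 \<le> s"
    then have "lmem (fact (enc f) (list_encode (n # xs)) 0) (comps ?Q s)"
      using s1 comps_mono by (meson max.boundedE)
    moreover have "\<exists>k<comps ?Q s. lmem (fact (enc f) (list_encode (m # xs)) (Suc k)) (comps ?Q s)"
      if "m < n" for m
      using s s2 that fact_less Suc_lessD by (metis max.boundedE)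
    ultimately show "rule_step ?Q (comps ?Q s) (e1 (enc (Mu f))) (e2 (enc (Mu f))) (list_encode xs) n"
      by (simp add: rule_step_def del: list_encode.simps)
  qed
next
  case (ev_orc x xs)
  show ?case
    by (rule comps_intro) (auto simp: rule_step_def simp del: list_encode.simps)
next
  case (ev_succ x xs)
  show ?case
    by (rule comps_intro) (auto simp: rule_step_def simp del: list_encode.simps)
qed (auto intro!: comps_intro simp: rule_step_def)

lemma eval_iff_comps:
  "eval A c xs v \<longleftrightarrow> (\<exists>s. lmem (fact (enc c) (list_encode xs) v) (comps (\<lambda>x. x \<in> A) s))"
  using comps_sound comps_complete by blast


subsection \<open>Jumps and the limit lemma\<close>

lemma enc_inj: "enc c = enc c' \<Longrightarrow> c = c'"
proof (induction c arbitrary: c')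
  case (Comp f gs)
  then obtain f' gs' where c': "c' = Comp f' gs'" "enc f = enc f'" "map enc gs = map enc gs'"
    by (cases c') (auto simp: list_encode_eq)
  have "gs = gs'"
    by (rule list.inj_map_strong[OF _ c'(3)]) (use Comp.IH(2) in blast)
  then show ?case using Comp.IH(1) c' by simp
next
  case (Prec f g)
  then show ?case by (cases c') auto
next
  case (Mu f)
  then show ?case by (cases c') auto
qed (case_tac c'; simp)+

text \<open>An unbounded search through a decidable relation halts exactly if there is a
  witness.\<close>

lemma domain_program:
  assumes "dec A (\<lambda>p. R (e1 p) (e2 p))"
  shows "\<exists>q. \<forall>n. (\<exists>v. eval A q [n] v) \<longleftrightarrow> (\<exists>s. R n s)"
proof -
  have "dec A (\<lambda>q. \<not> R (e2 q) (e1 q))"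
    by (intro cf_intros dec_lift2[OF assms])
  then obtain q where q: "eval A q [s, n] (of_bool (\<not> R n s))" for s n
    using cf2_of_cf[of A "\<lambda>s n. of_bool (\<not> R n s)"] unfolding dec_def cf2_def by auto
  have "(\<exists>v. eval A (Mu q) [n] v) \<longleftrightarrow> (\<exists>s. R n s)" for n
  proof
    assume "\<exists>v. eval A (Mu q) [n] v"
    then obtain v where "eval A q [v, n] 0" by (auto elim: eval.cases)
    from eval_deterministic[OF this q] have "R n v" by simp
    then show "\<exists>s. R n s" ..
  next
    assume ex: "\<exists>s. R n s"
    have "eval A (Mu q) [n] (LEAST s. R n s)"
    proof (rule ev_mu)
      show "eval A q [LEAST s. R n s, n] 0"
        using q[of "LEAST s. R n s" n] LeastI_ex[OF ex] by simp
      show "\<forall>m<LEAST s. R n s. \<exists>k. eval A q [m, n] (Suc k)"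
      proof (intro allI impI)
        fix m assume "m < (LEAST s. R n s)"
        then show "\<exists>k. eval A q [m, n] (Suc k)"
          using q[of m n] not_less_Least[of m "R n"] by (auto intro!: exI[of _ 0])
      qed
    qed
    then show "\<exists>v. eval A (Mu q) [n] v" ..
  qed
  then show ?thesis by blast
qed

text \<open>Freezing the input into the program reduces the domain of a program to the
  diagonal halting set.\<close>

lemma dec_jump:
  assumes "dec A (\<lambda>p. R (e1 p) (e2 p))"
  shows "dec (jump A) (\<lambda>n. \<exists>s. R n s)"
proof -
  obtain q where q: "(\<exists>v. eval A q [n] v) \<longleftrightarrow> (\<exists>s. R n s)" for n
    using domain_program[OF assms] by blast
  define idx where "idx n = enc (Comp q [cst n])" for n
  \<comment> \<open>\<open>cst (Suc n)\<close> wraps \<open>cst n\<close> in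
    \<open>Comp Succ\<close>, so its code arises by primitive recursion; 4 is the tag of
    \<open>Comp\<close>.\<close>
  have "enc (cst n) =
      rec_nat (enc Zero) (\<lambda>_ u. prod_encode (4, prod_encode (enc Succ, lcons u 0))) n" for n
    by (induction n) (simp_all add: lcons_def)
  then have idx: "idx n = prod_encode (4, prod_encode (enc q, lcons
      (rec_nat (enc Zero) (\<lambda>_ u. prod_encode (4, prod_encode (enc Succ, lcons u 0))) n) 0))" for n
    unfolding idx_def by (simp add: lcons_def)
  have "cf (jump A) idx"
    unfolding idx[abs_def] by (intro cfl_intros cf_rec)
  then have "dec (jump A) (\<lambda>n. idx n \<in> jump A)"
    by (rule dec_comp[OF dec_oracle])
  moreover have "idx n \<in> jump A \<longleftrightarrow> (\<exists>s. R n s)" for n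
  proof -
    \<comment> \<open>The jump feeds the program its own code, but \<open>cst n\<close> discards
      this input.\<close>
    have "idx n \<in> jump A \<longleftrightarrow> (\<exists>v. eval A (Comp q [cst n]) [idx n] v)"
      unfolding jump_def idx_def using enc_inj by blast
    also have "\<dots> \<longleftrightarrow> (\<exists>v. eval A q [n] v)"
    proof
      assume "\<exists>v. eval A (Comp q [cst n]) [idx n] v"
      then obtain ys v where ys: "length ys = 1" "eval A (cst n) [idx n] (ys ! 0)" "eval A q ys v"
        by (auto elim!: eval.cases[of A "Comp q [cst n]"])
      then have "ys = [n]"
        using eval_deterministic[OF eval_cst] by (cases ys) auto
      then show "\<exists>v. eval A q [n] v" using ys by blast
    qed (use eval_comp1[OF eval_cst] in blast)
    finally show ?thesis using q by simp
  qed
  ultimately show ?thesis by simp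
qed

text \<open>The first conjunct excludes numbers that are not program codes: \<open>rule_step\<close>
  derives facts for some of them too, since tag 0, for instance, ignores \<open>a\<close>.\<close>

definition jump_stage :: "nat set \<Rightarrow> nat \<Rightarrow> nat \<Rightarrow> bool" where
  "jump_stage A t x \<longleftrightarrow> lmem x (stage code_step t) \<and>
    (\<exists>v<comps (\<lambda>x. x \<in> A) t. lmem (fact x (lcons x 0) v) (comps (\<lambda>x. x \<in> A) t))"

lemma cf_comps_oracle: "cf A f \<Longrightarrow> cf A (\<lambda>x. comps (\<lambda>x. x \<in> A) (f x))"
  by (rule cf_comps[where Q="\<lambda>_ x. x \<in> A"]) (intro dec_comp[OF dec_oracle] cf_intros)

lemma dec_jump_stage: "dec A (\<lambda>p. jump_stage A (e1 p) (e2 p))"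
  unfolding jump_stage_def
  by (intro cfl_intros cf_fact cf_code_stage cf_comps_oracle)

lemma lcons_0: "lcons x 0 = list_encode [x]"
  by (simp add: lcons_def)

text \<open>Both enumerations only grow, so a true membership is eventually confirmed for good,
  while soundness rules out any false confirmation.\<close>

lemma jump_stage_eventually: "\<forall>\<^sub>F t in sequentially. jump_stage A t x \<longleftrightarrow> x \<in> jump A"
proof (cases "x \<in> jump A")
  case True
  then obtain c v where c: "x = enc c" "eval A c [x] v" unfolding jump_def by blast
  then obtain s1 where s1: "lmem (fact x (lcons x 0) v) (comps (\<lambda>x. x \<in> A) s1)"
    unfolding eval_iff_comps lcons_0 by blast
  obtain s2 where s2: "lmem x (stage code_step s2)" using code_complete c by blast
  have "jump_stage A t x" if "t \<ge> max s1 s2" for t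
  proof -
    have "lmem (fact x (lcons x 0) v) (comps (\<lambda>x. x \<in> A) t)" "lmem x (stage code_step t)"
      using that comps_mono[OF s1] stage_mono[OF s2] by simp_all
    then show ?thesis unfolding jump_stage_def using fact_less by blast
  qed
  then show ?thesis using True unfolding eventually_sequentially by blast
next
  case False
  have "\<not> jump_stage A t x" for t
  proof
    assume *: "jump_stage A t x"
    then obtain c where "x = enc c" unfolding jump_stage_def using code_sound by blast
    with * False show False
      unfolding jump_stage_def jump_def lcons_0 using comps_sound by blast
  qed
  then show ?thesis using False by simp
qed

text \<open>The use of a computation is finite: step \<open>s\<close> examines the single candidate
  \<open>e1 s\<close> and consults the oracle only at the head of its input. Pointwise convergence
  therefore gives agreement up to any fixed stage.\<close>

lemma comps_eventually:
  assumes "\<And>x. \<forall>\<^sub>F t in F. J t x \<longleftrightarrow> Q x"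
  shows "\<forall>\<^sub>F t in F. comps (J t) s = comps Q s"
proof (induction s)
  case (Suc s)
  have "\<forall>\<^sub>F t in F. J t (lhd (e1 (e2 (e1 s)))) \<longleftrightarrow> Q (lhd (e1 (e2 (e1 s))))"
    by (rule assms)
  with Suc show ?case
  proof eventually_elim
    case (elim t)
    have "eval_step (J t) D (e1 s) \<longleftrightarrow> eval_step Q D (e1 s)" for D
      unfolding eval_step_def rule_step_def elim(2) ..
    then show ?case using elim(1) unfolding comps_def by (simp add: stage_Suc)
  qed
qed (simp add: comps_def)

text \<open>The approximation runs the reduction with oracle \<open>jump_stage A t\<close> and reports the value of
  the first computation found.\<close>

lemma limit_lemma:
  assumes "dec (jump A) P"
  shows "\<exists>G. dec A (\<lambda>p. G (e1 p) (e2 p)) \<and> (\<forall>n. \<forall>\<^sub>F t in sequentially. G n t \<longleftrightarrow> P n)"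
proof -
  obtain c where c: "eval (jump A) c [n] (of_bool (P n))" for n
    using assms unfolding dec_def cf_def by blast
  define M where "M n b t s \<longleftrightarrow> lmem (fact (enc c) (lcons n 0) b) (comps (jump_stage A t) s)" for n b t s
  define M' where "M' n b s \<longleftrightarrow>
    lmem (fact (enc c) (lcons n 0) b) (comps (\<lambda>x. x \<in> jump A) s)" for n b s
  \<comment> \<open>The disjunct \<open>t \<le> s\<close> keeps the search total when the
    approximate oracle yields no answer 0 or 1.\<close>
  define r where "r n t = (LEAST s. t \<le> s \<or> M n 0 t s \<or> M n 1 t s)" for n t
  define G where "G n t \<longleftrightarrow> M n 1 t (r n t)" for n t
  have M: "dec A (\<lambda>x. M (f x) (h x) (i x) (j x))" if "cf A f" "cf A h" "cf A i" "cf A j" for f h i j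
  proof -
    have "cf A (\<lambda>p. comps (jump_stage A (e1 p)) (e2 p))"
      by (rule cf_comps) (intro cf_intros dec_lift2[OF dec_jump_stage])+
    then have "cf A (\<lambda>x. comps (jump_stage A (i x)) (j x))"
      using that(3,4) by (rule cf_lift2[where F="\<lambda>a b. comps (jump_stage A a) b"])
    then show ?thesis
      unfolding M_def by (intro cfl_intros cf_fact that)
  qed
  have "cf A (\<lambda>p. r (e1 p) (e2 p))"
    unfolding r_def by (rule cf_Least) (intro cf_intros M, blast)
  then have "dec A (\<lambda>p. G (e1 p) (e2 p))"
    unfolding G_def by (intro M cf_intros)
  moreover have "\<forall>\<^sub>F t in sequentially. G n t \<longleftrightarrow> P n" for n
  proof -
    have M'_iff: "(\<exists>s. M' n b s) \<longleftrightarrow> b = of_bool (P n)" for b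
      using eval_iff_comps[of "jump A" c "[n]" b] eval_deterministic c
      unfolding M'_def lcons_0 by blast
    \<comment> \<open>The first stage at which the true computation answers. Once the approximations
      agree with the true oracle through \<open>s0\<close>, no earlier stage answers, and
      \<open>r n t\<close> equals \<open>s0\<close>.\<close>
    define s0 where "s0 = (LEAST s. M' n 0 s \<or> M' n 1 s)"
    have "\<exists>s. M' n 0 s \<or> M' n 1 s"
      using M'_iff[of "of_bool (P n)"] by (cases "P n") auto
    then have s0: "M' n 0 s0 \<or> M' n 1 s0" unfolding s0_def by (rule LeastI_ex)
    have s0_min: "\<not> M' n 0 s" "\<not> M' n 1 s" if "s < s0" for s
      using not_less_Least that unfolding s0_def by blast+
    have "\<forall>\<^sub>F t in sequentially. \<forall>s\<in>{..s0}.
        comps (jump_stage A t) s = comps (\<lambda>x. x \<in> jump A) s"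
      by (intro eventually_ball_finite ballI comps_eventually jump_stage_eventually) simp
    moreover have "\<forall>\<^sub>F t in sequentially. s0 < t"
      by (rule eventually_gt_at_top)
    ultimately show ?thesis
    proof eventually_elim
      case (elim t)
      then have M_eq: "M n b t s \<longleftrightarrow> M' n b s" if "s \<le> s0" for b s
        using that unfolding M_def M'_def by simp
      have "r n t = s0"
        unfolding r_def
      proof (rule Least_equality)
        fix s assume "t \<le> s \<or> M n 0 t s \<or> M n 1 t s"
        then show "s0 \<le> s"
          using elim(2) M_eq s0_min by (metis leI less_imp_le order.trans)
      qed (use s0 M_eq in simp)
      then have "G n t \<longleftrightarrow> M' n 1 s0" unfolding G_def using M_eq by simp
      also have "\<dots> \<longleftrightarrow> P n" using s0 M'_iff[of 0] M'_iff[of 1] by (cases "P n") auto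
      finally show ?case .
    qed
  qed
  ultimately show ?thesis by blast
qed

text \<open>Lowness makes \<open>P\<close> decidable in \<open>jump (jump {})\<close>; each use of
  the limit lemma then trades one jump for one limit variable.\<close>

lemma low2_double_limit:
  assumes "low2 d" "dec (jump (jump d)) P"
  shows "\<exists>H G. dec {} (\<lambda>p. H (e1 p) (e1 (e2 p)) (e2 (e2 p)))
    \<and> (\<forall>n a. \<forall>\<^sub>F t in sequentially. H n a t \<longleftrightarrow> G n a) \<and> (\<forall>n. \<forall>\<^sub>F a in sequentially. G n a \<longleftrightarrow> P n)"
proof -
  have "dec (jump (jump {})) P"
    using dec_trans assms unfolding low2_def by blast
  from limit_lemma[OF this] obtain G where
    G: "dec (jump {}) (\<lambda>p. G (e1 p) (e2 p))" "\<forall>n. \<forall>\<^sub>F a in sequentially. G n a \<longleftrightarrow> P n" by blast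
  from limit_lemma[OF G(1)] obtain K where
    K: "dec {} (\<lambda>p. K (e1 p) (e2 p))" "\<forall>n. \<forall>\<^sub>F t in sequentially. K n t \<longleftrightarrow> G (e1 n) (e2 n)" by blast
  have "dec {} (\<lambda>p. K (prod_encode (e1 p, e1 (e2 p))) (e2 (e2 p)))"
    by (intro dec_lift2[OF K(1)] cf_intros)
  moreover have "\<forall>\<^sub>F t in sequentially. K (prod_encode (n, a)) t \<longleftrightarrow> G n a" for n a
    using K(2)[rule_format, of "prod_encode (n, a)"] by simp
  ultimately show ?thesis
    by (intro exI[of _ "\<lambda>n a. K (prod_encode (n, a))"] exI[of _ G]) (use G(2) in blast)
qed

subsection \<open>Blocks\<close>

text \<open>\<open>c i t\<close> is the approximation at stage \<open>t\<close> of the colour intended for the \<open>i\<close>-th block of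
  numbers. Whenever the colour of block \<open>i\<close> changes, all later blocks are merged into it.\<close>

definition blk :: "(nat \<Rightarrow> nat \<Rightarrow> nat) \<Rightarrow> nat \<Rightarrow> nat \<Rightarrow> nat" where
  "blk c x s = (LEAST i. x \<le> i \<or> (\<exists>u<s. x \<le> u \<and> c i u \<noteq> c i (Suc u)))"

definition bcol :: "(nat \<Rightarrow> nat \<Rightarrow> nat) \<Rightarrow> nat \<Rightarrow> nat \<Rightarrow> nat" where
  "bcol c x s = c (blk c x s) s"

lemma blk_prop: "x \<le> blk c x s \<or> (\<exists>u<s. x \<le> u \<and> c (blk c x s) u \<noteq> c (blk c x s) (Suc u))"
  unfolding blk_def by (rule LeastI[of _ x]) simp

lemma blk_le: "x \<le> i \<or> (\<exists>u<s. x \<le> u \<and> c i u \<noteq> c i (Suc u)) \<Longrightarrow> blk c x s \<le> i"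
  unfolding blk_def by (rule Least_le)

lemma blk_mono:
  shows "s \<le> t \<Longrightarrow> blk c x t \<le> blk c x s" and "x \<le> y \<Longrightarrow> blk c x s \<le> blk c y s"
proof -
  show "blk c x t \<le> blk c x s" if "s \<le> t"
    using blk_prop[of x c s] that by (intro blk_le) (auto intro: less_le_trans)
  show "blk c x s \<le> blk c y s" if "x \<le> y"
    using blk_prop[of y c s] that by (intro blk_le) (auto intro: le_trans)
qed

text \<open>Let \<open>i\<close> be the block of \<open>x\<close> at stage \<open>z\<close>. If the
  colour of \<open>x\<close> changes between \<open>y\<close> and \<open>z\<close>, then either
  \<open>i\<close> changed colour in that interval, or \<open>x\<close> entered \<open>i\<close>
  then, which is also caused by a colour change of \<open>i\<close>. That change draws
  \<open>y\<close> into block \<open>i\<close> as well.\<close>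

lemma bcol_cut:
  assumes "x < y" "y < z" "bcol c x y \<noteq> bcol c x z"
  shows "bcol c y z = bcol c x z"
proof -
  define i where "i = blk c x z"
  have le: "i \<le> blk c x y"
    unfolding i_def using less_imp_le[OF assms(2)] by (rule blk_mono(1))
  have ge: "i \<le> blk c y z"
    unfolding i_def using less_imp_le[OF assms(1)] by (rule blk_mono(2))
  have "\<exists>u<z. y \<le> u \<and> c i u \<noteq> c i (Suc u)"
  proof (cases "i = blk c x y")
    case True
    then have ne: "c i y \<noteq> c i z" using assms(3) unfolding bcol_def i_def by simp
    show ?thesis
    proof (rule ccontr)
      assume const: "\<not> ?thesis"
      have "c i w = c i y" if "y \<le> w" "w \<le> z" for w
        using that
      proof (induction rule: dec_induct)
        case (step n)
        from step.prems have "n < z" by simp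
        with const step.hyps(1) have "c i n = c i (Suc n)" by metis
        with step.IH \<open>n < z\<close> show ?case by simp
      qed simp
      from this[of z] show False using ne assms(2) by simp
    qed
  next
    case False
    then have "\<not> blk c x y \<le> i" using le by simp
    then have "\<not> (x \<le> i \<or> (\<exists>u<y. x \<le> u \<and> c i u \<noteq> c i (Suc u)))"
      using blk_le[of x i y c] by (rule contrapos_nn)
    moreover have "x \<le> i \<or> (\<exists>u<z. x \<le> u \<and> c i u \<noteq> c i (Suc u))"
      unfolding i_def by (rule blk_prop)
    ultimately obtain u where "u < z" "c i u \<noteq> c i (Suc u)" "\<not> u < y" by blast
    then show ?thesis by (intro exI[of _ u]) simp
  qed
  then have "blk c y z \<le> i" by (intro blk_le) blast
  then have "blk c y z = i" using ge by simp
  then show ?thesis unfolding bcol_def i_def by simp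
qed

text \<open>By \<open>blk_mono\<close> the index is nonincreasing in \<open>s\<close>, so it settles
  at its least value.\<close>

lemma blk_eventually: "\<exists>b. \<forall>\<^sub>F s in sequentially. blk c x s = b"
proof -
  define b where "b = (LEAST b. \<exists>s. blk c x s = b)"
  have "\<exists>s. blk c x s = b" unfolding b_def by (rule LeastI[of _ "blk c x 0"]) blast
  then obtain s0 where s0: "blk c x s0 = b" ..
  have "blk c x s = b" if "s0 \<le> s" for s
  proof (rule antisym)
    show "blk c x s \<le> b"
      unfolding s0[symmetric] using that by (rule blk_mono(1))
    show "b \<le> blk c x s" unfolding b_def by (rule Least_le) blast
  qed
  then show ?thesis unfolding eventually_sequentially by blast
qed

lemma bcol_limit:
  assumes "\<And>i. \<forall>\<^sub>F t in sequentially. c i t = C i"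
  shows "\<exists>v. \<forall>\<^sub>F s in sequentially. bcol c x s = v"
proof -
  obtain b where "\<forall>\<^sub>F s in sequentially. blk c x s = b" using blk_eventually by blast
  with assms[of b] have "\<forall>\<^sub>F s in sequentially. bcol c x s = C b"
    unfolding bcol_def by eventually_elim simp
  then show ?thesis by blast
qed

text \<open>Only colour changes at stages from \<open>x\<close> on can merge \<open>x\<close> into
  an earlier block. Hence a number beyond \<open>I\<close>, and beyond the stage \<open>T\<close> by
  which all blocks below \<open>I\<close> have settled, stays in blocks of index at least
  \<open>I\<close>.\<close>

lemma bcol_limit_const:
  assumes "\<And>i. \<forall>\<^sub>F t in sequentially. c i t = C i" and "\<forall>\<^sub>F i in sequentially. C i = v"
  shows "\<exists>m. \<forall>x\<ge>m. \<forall>\<^sub>F s in sequentially. bcol c x s = v"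
proof -
  obtain I where I: "\<forall>i\<ge>I. C i = v" using assms(2) unfolding eventually_sequentially by blast
  have "\<forall>\<^sub>F t in sequentially. \<forall>i\<in>{..<I}. c i t = C i"
    by (intro eventually_ball_finite ballI assms(1)) simp
  then obtain T where T: "\<forall>t\<ge>T. \<forall>i<I. c i t = C i" unfolding eventually_sequentially by auto
  have "\<forall>\<^sub>F s in sequentially. bcol c x s = v" if x: "max I T \<le> x" for x
  proof -
    have ge: "I \<le> blk c x s" for s
      using blk_prop[of x c s] T x by (metis le_SucI le_trans max.boundedE not_le)
    obtain b where b: "\<forall>\<^sub>F s in sequentially. blk c x s = b" using blk_eventually by blast
    then have "I \<le> b" using ge unfolding eventually_sequentially by (metis le_refl)
    then have "C b = v" using I by simp
    from b assms(1)[of b] show ?thesis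
      unfolding bcol_def by eventually_elim (simp add: \<open>C b = v\<close>)
  qed
  then show ?thesis by blast
qed

subsection \<open>A computable stable colouring defeating a low\<open>\<^sub>2\<close> set\<close>

text \<open>For a program code \<open>e\<close> this is \<open>W\<^sub>e\<^sup>d\<close>. A single
  \<open>w\<close> codes output and stage, the shape that \<open>dec_jump\<close> expects.\<close>

definition dom_of :: "nat set \<Rightarrow> nat \<Rightarrow> nat \<Rightarrow> bool" where
  "dom_of d e x \<longleftrightarrow> (\<exists>w. lmem (fact e (lcons x 0) (e1 w)) (comps (\<lambda>x. x \<in> d) (e2 w)))"

text \<open>The requirement \<open>j = \<langle>e, a\<rangle>\<close> for the colouring \<open>(y, s) \<mapsto> \<Phi>\<^sub>k(k, y, s)\<close>: if \<open>W\<^sub>e\<^sup>d\<close> is infinite,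
  then it has an element of limit colour \<open>a\<close>. Passing \<open>k\<close> as an argument to program \<open>k\<close> takes
  the place of the recursion theorem.\<close>

definition req :: "nat set \<Rightarrow> nat \<Rightarrow> nat \<Rightarrow> bool" where
  "req d j k \<longleftrightarrow> (\<exists>b. \<not> (\<exists>x. b < x \<and> dom_of d (e1 j) x)) \<or>
    (\<exists>y N. dom_of d (e1 j) y \<and> \<not> (\<exists>s v. N \<le> s \<and> v \<noteq> e2 j \<and>
       (\<exists>t. lmem (fact k (lcons (prod_encode (k, prod_encode (y, s))) 0) v) (comps (\<lambda>_. False) t))))"

lemma dom_of_enc: "dom_of d (enc q) x \<longleftrightarrow> (\<exists>v. eval d q [x] v)"
  unfolding dom_of_def eval_iff_comps lcons_0
  by (rule ex_pair[where P="\<lambda>v t. lmem (fact (enc q) (list_encode [x]) v) (comps (\<lambda>x. x \<in> d) t)"])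

text \<open>Both disjuncts of \<open>req\<close> put existential quantifiers in front of a condition
  decidable in \<open>jump d\<close>, so two rounds of \<open>dec_jump\<close> suffice.\<close>

lemma dec_req: "dec (jump (jump d)) (\<lambda>p. req d (e1 p) (e2 p))"
proof -
  have cf_empty: "cf d f \<Longrightarrow> cf d (\<lambda>x. comps (\<lambda>_. False) (f x))" for f
    by (rule cf_comps[where Q="\<lambda>_ _. False"]) (intro cf_intros)
  have "dec (jump d) (\<lambda>p. \<exists>w. e2 p < e1 w \<and>
      lmem (fact (e1 p) (lcons (e1 w) 0) (e1 (e2 w))) (comps (\<lambda>x. x \<in> d) (e2 (e2 w))))"
    by (rule dec_jump) (intro cfl_intros cf_fact cf_comps_oracle)
  moreover have "(\<exists>w. b < e1 w \<and> lmem (fact e (lcons (e1 w) 0) (e1 (e2 w)))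
      (comps (\<lambda>x. x \<in> d) (e2 (e2 w)))) \<longleftrightarrow> (\<exists>x. b < x \<and> dom_of d e x)" for b e
    unfolding dom_of_def
    using ex_pair[of "\<lambda>x u. b < x \<and> lmem (fact e (lcons x 0) (e1 u)) (comps (\<lambda>x. x \<in> d) (e2 u))"]
    by blast
  ultimately have E1: "dec (jump d) (\<lambda>p. \<exists>x. e2 p < x \<and> dom_of d (e1 p) x)" by simp
  have E2: "dec (jump d) (\<lambda>p. dom_of d (e1 p) (e2 p))"
    unfolding dom_of_def by (rule dec_jump) (intro cfl_intros cf_fact cf_comps_oracle)
  \<comment> \<open>The quantifiers over \<open>s\<close>, \<open>v\<close> and \<open>t\<close> are
    contracted into the one variable \<open>w\<close>.\<close>
  define S where "S k a y N w \<longleftrightarrow> N \<le> e1 w \<and> e1 (e2 w) \<noteq> a \<and>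
      lmem (fact k (lcons (prod_encode (k, prod_encode (y, e1 w))) 0) (e1 (e2 w)))
        (comps (\<lambda>_. False) (e2 (e2 w)))" for k a y N w
  have S: "(\<exists>w. S k a y N w) \<longleftrightarrow> (\<exists>s v. N \<le> s \<and> v \<noteq> a \<and>
       (\<exists>t. lmem (fact k (lcons (prod_encode (k, prod_encode (y, s))) 0) v) (comps (\<lambda>_. False) t)))"
    for k a y N
    unfolding S_def
    using ex_pair[of "\<lambda>s u. N \<le> s \<and> e1 u \<noteq> a \<and>
        lmem (fact k (lcons (prod_encode (k, prod_encode (y, s))) 0) (e1 u)) (comps (\<lambda>_. False) (e2 u))"]
      ex_pair[of "\<lambda>v t. N \<le> s \<and> v \<noteq> a \<and>
        lmem (fact k (lcons (prod_encode (k, prod_encode (y, s))) 0) v) (comps (\<lambda>_. False) t)" for s]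
    by blast
  have E3: "dec (jump d) (\<lambda>p. \<exists>w. S (e1 (e1 p)) (e2 (e1 p)) (e1 (e2 p)) (e2 (e2 p)) w)"
    by (rule dec_jump) (unfold S_def, intro cfl_intros cf_fact cf_empty)
  have E3': "dec (jump d) (\<lambda>x. \<exists>w. S (f1 x) (f2 x) (f3 x) (f4 x) w)"
    if "cf (jump d) f1" "cf (jump d) f2" "cf (jump d) f3" "cf (jump d) f4" for f1 f2 f3 f4
    using dec_comp[OF E3, of "\<lambda>x. prod_encode (prod_encode (f1 x, f2 x), prod_encode (f3 x, f4 x))"] that
    by (simp add: cf_pair)
  \<comment> \<open>The same \<open>w\<close> serves as the bound \<open>b\<close> in the first
    disjunct and as the pair of \<open>y\<close> and \<open>N\<close> in the second.\<close>
  have "dec (jump (jump d)) (\<lambda>p. \<exists>w. \<not> (\<exists>x. w < x \<and> dom_of d (e1 (e1 p)) x) \<or>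
      dom_of d (e1 (e1 p)) (e1 w) \<and> \<not> (\<exists>u. S (e2 p) (e2 (e1 p)) (e1 w) (e2 w) u))"
    by (rule dec_jump)
       (intro cf_intros dec_lift2[OF E2] E3'
          dec_lift2[where P="\<lambda>e b. \<exists>x. b < x \<and> dom_of d e x", OF E1])
  moreover have "(\<exists>w. \<not> (\<exists>x. w < x \<and> dom_of d (e1 j) x) \<or>
      dom_of d (e1 j) (e1 w) \<and> \<not> (\<exists>u. S k (e2 j) (e1 w) (e2 w) u)) \<longleftrightarrow> req d j k" for j k
    using ex_pair[of "\<lambda>y N. dom_of d (e1 j) y \<and> \<not> (\<exists>u. S k (e2 j) y N u)"]
    unfolding req_def S ex_disj_distrib by simp
  ultimately show ?thesis by simp
qed

text \<open>The second clause will give transitivity of a linear order. The last one concerns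
  projections of relations decidable in \<open>d\<close>, because the range of a sequence computable
  in \<open>d\<close> arises in this form.\<close>

lemma defeating_colouring:
  assumes "low2 d"
  obtains g where "cf {} (\<lambda>p. g (e1 p) (e2 p))"
    and "\<And>x y z. x < y \<Longrightarrow> y < z \<Longrightarrow> g x y \<noteq> g x z \<Longrightarrow> g y z = g x z"
    and "\<And>x. \<exists>v. \<forall>\<^sub>F s in sequentially. g x s = v"
    and "\<And>R a. dec d (\<lambda>p. R (e1 p) (e2 p)) \<Longrightarrow> infinite {x. \<exists>t. R x t} \<Longrightarrow>
           \<exists>x t. R x t \<and> (\<forall>\<^sub>F s in sequentially. g x s = a)"
proof -
  obtain H G where H: "dec {} (\<lambda>p. H (e1 p) (e1 (e2 p)) (e2 (e2 p)))"
    and HG: "\<And>n i. \<forall>\<^sub>F t in sequentially. H n i t \<longleftrightarrow> G n i"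
    and G: "\<And>n. \<forall>\<^sub>F i in sequentially. G n i \<longleftrightarrow> req d (e1 n) (e2 n)"
    using low2_double_limit[OF assms dec_req] by blast
  \<comment> \<open>The colour of the least requirement below \<open>i\<close> that appears unmet;
    if there is none, the search stops at \<open>i\<close> itself.\<close>
  define col where "col k i t = e2 (LEAST j. i \<le> j \<or> \<not> H (prod_encode (j, k)) i t)" for k i t
  have "cf {} (\<lambda>p. LEAST j. e1 (e2 p) \<le> j \<or> \<not> H (prod_encode (j, e1 p)) (e1 (e2 p)) (e2 (e2 p)))"
    by (rule cf_Least) (intro cf_intros dec_lift3[OF H], blast)
  then have "cf {} (\<lambda>p. col (e1 p) (e1 (e2 p)) (e2 (e2 p)))"
    unfolding col_def by (rule cf_e2)
  then have col: "cf {} (\<lambda>x. col (f1 x) (f2 x) (f3 x))" if "cf {} f1" "cf {} f2" "cf {} f3" for f1 f2 f3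
    using cf_comp[of "{}" "\<lambda>p. col (e1 p) (e1 (e2 p)) (e2 (e2 p))"
        "\<lambda>x. prod_encode (f1 x, prod_encode (f2 x, f3 x))"] that by (simp add: cf_pair)
  have "cf {} (\<lambda>p. blk (col (e1 p)) (e1 (e2 p)) (e2 (e2 p)))"
    unfolding blk_def by (rule cf_Least) (intro cf_intros col, blast)
  then have "cf {} (\<lambda>p. bcol (col (e1 p)) (e1 (e2 p)) (e2 (e2 p)))"
    unfolding bcol_def by (intro col cf_intros)
  then obtain p where p: "eval {} p [n] (bcol (col (e1 n)) (e1 (e2 n)) (e2 (e2 n)))" for n
    unfolding cf_def by blast
  \<comment> \<open>Program \<open>p\<close> takes an index as part of its input. Given its own code
    it computes \<open>g\<close>, and these are the runs that \<open>req d j k\<close>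
    inspects.\<close>
  define k where "k = enc p"
  define g where "g = bcol (col k)"
  have "eval {} p [prod_encode (k, prod_encode (y, s))] (g y s)" for y s
    using p[of "prod_encode (k, prod_encode (y, s))"] by (simp add: g_def)
  then have "eval {} p [prod_encode (k, prod_encode (y, s))] v \<longleftrightarrow> v = g y s" for y s v
    using eval_deterministic by blast
  then have run: "(\<exists>t. lmem (fact k (lcons (prod_encode (k, prod_encode (y, s))) 0) v) (comps (\<lambda>_. False) t))
      \<longleftrightarrow> v = g y s" for y s v
    unfolding eval_iff_comps k_def lcons_0 by simp
  have req_iff: "req d j k \<longleftrightarrow> (\<exists>b. \<forall>x>b. \<not> dom_of d (e1 j) x) \<or>
      (\<exists>y. dom_of d (e1 j) y \<and> (\<forall>\<^sub>F s in sequentially. g y s = e2 j))" for j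
  proof -
    have "\<not> (\<exists>s v. N \<le> s \<and> v \<noteq> e2 j \<and> v = g y s) \<longleftrightarrow> (\<forall>s\<ge>N. g y s = e2 j)" for y N by blast
    then show ?thesis unfolding req_def run eventually_sequentially by blast
  qed
  define C where "C i = e2 (LEAST j. i \<le> j \<or> \<not> G (prod_encode (j, k)) i)" for i
  \<comment> \<open>Block \<open>i\<close> consults only requirements below \<open>i\<close>, so
    finitely many approximations have to settle.\<close>
  have lim: "\<forall>\<^sub>F t in sequentially. col k i t = C i" for i
  proof -
    have "\<forall>\<^sub>F t in sequentially. \<forall>j\<in>{..<i}. H (prod_encode (j, k)) i t \<longleftrightarrow> G (prod_encode (j, k)) i"
      by (intro eventually_ball_finite ballI HG) simp
    then show ?thesis
    proof eventually_elim
      case (elim t)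
      then have "(i \<le> j \<or> \<not> H (prod_encode (j, k)) i t) \<longleftrightarrow> (i \<le> j \<or> \<not> G (prod_encode (j, k)) i)" for j
        using not_le by blast
      then show ?case unfolding col_def C_def by simp
    qed
  qed
  have all_req: "req d j k" for j
  proof (rule ccontr)
    assume "\<not> req d j k"
    define j0 where "j0 = (LEAST j. \<not> req d j k)"
    have j0: "\<not> req d j0 k" unfolding j0_def using \<open>\<not> req d j k\<close> by (rule LeastI)
    have below: "req d j k" if "j < j0" for j using not_less_Least that unfolding j0_def by blast
    \<comment> \<open>For late blocks the guesses are right on all of the finitely many
      \<open>j \<le> j0\<close>, so these blocks aim at the colour of \<open>j0\<close>.\<close>
    have "\<forall>\<^sub>F i in sequentially. \<forall>j\<in>{..j0}. G (prod_encode (j, k)) i \<longleftrightarrow> req d j k"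
      using G[of "prod_encode (_, k)"] by (intro eventually_ball_finite ballI) auto
    moreover have "\<forall>\<^sub>F i in sequentially. j0 < i" by (rule eventually_gt_at_top)
    ultimately have "\<forall>\<^sub>F i in sequentially. C i = e2 j0"
    proof eventually_elim
      case (elim i)
      have "(LEAST j. i \<le> j \<or> \<not> G (prod_encode (j, k)) i) = j0"
      proof (rule Least_equality)
        fix j assume "i \<le> j \<or> \<not> G (prod_encode (j, k)) i"
        then show "j0 \<le> j" using elim below by (metis atMost_iff le_trans less_imp_le not_le)
      qed (use elim j0 in simp)
      then show ?case unfolding C_def by simp
    qed
    from bcol_limit_const[OF lim this] obtain m where
      m: "\<forall>x\<ge>m. \<forall>\<^sub>F s in sequentially. g x s = e2 j0" unfolding g_def by blast
    \<comment> \<open>As \<open>j0\<close> is unmet, its c.e. set is unbounded and has an element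
      beyond \<open>m\<close>; that element has the desired limit colour and meets
      \<open>j0\<close>.\<close>
    show False using j0 m unfolding req_iff by (meson less_imp_le)
  qed
  show thesis
  proof (rule that)
    have "cf {} (\<lambda>p. bcol (col (e1 (prod_encode (k, p)))) (e1 (e2 (prod_encode (k, p)))) (e2 (e2 (prod_encode (k, p)))))"
      using \<open>cf {} (\<lambda>p. bcol (col (e1 p)) (e1 (e2 p)) (e2 (e2 p)))\<close>
      by (rule cf_comp) (intro cf_intros)
    then show "cf {} (\<lambda>p. g (e1 p) (e2 p))" unfolding g_def by simp
    show "g y z = g x z" if "x < y" "y < z" "g x y \<noteq> g x z" for x y z
      using bcol_cut that unfolding g_def by blast
    show "\<exists>v. \<forall>\<^sub>F s in sequentially. g x s = v" for x
      unfolding g_def by (rule bcol_limit[OF lim])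
    show "\<exists>x t. R x t \<and> (\<forall>\<^sub>F s in sequentially. g x s = a)"
      if R: "dec d (\<lambda>p. R (e1 p) (e2 p))" and inf: "infinite {x. \<exists>t. R x t}" for R a
    proof -
      obtain q where "(\<exists>v. eval d q [n] v) \<longleftrightarrow> (\<exists>s. R n s)" for n
        using domain_program[OF R] by blast
      then have q: "dom_of d (enc q) x \<longleftrightarrow> (\<exists>t. R x t)" for x unfolding dom_of_enc by blast
      have "\<exists>x>b. \<exists>t. R x t" for b
        using inf unfolding infinite_nat_iff_unbounded by blast
      moreover have "(\<exists>b. \<forall>x>b. \<not> (\<exists>t. R x t)) \<or>
          (\<exists>y. (\<exists>t. R y t) \<and> (\<forall>\<^sub>F s in sequentially. g y s = a))"
        using all_req[of "prod_encode (enc q, a)"] unfolding req_iff e1_pair e2_pair q .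
      ultimately show ?thesis by blast
    qed
  qed
qed

subsection \<open>Stable thin sets and stable linear orders\<close>

text \<open>A solution computable in \<open>d\<close> would contain some \<open>x\<close> whose
  limit colour is the omitted colour \<open>a\<close>, and \<open>x\<close> takes this colour with
  all large members of the infinite solution.\<close>

lemma STS2_instance:
  assumes "low2 d"
  shows "\<exists>X. inst STS2 X \<and> computable X \<and> (\<forall>W. turing_le W d \<longrightarrow> \<not> sol STS2 X W)"
proof -
  obtain g where g: "cf {} (\<lambda>p. g (e1 p) (e2 p))"
    and "\<And>x y z. x < y \<Longrightarrow> y < z \<Longrightarrow> g x y \<noteq> g x z \<Longrightarrow> g y z = g x z"
    and lim: "\<And>x. \<exists>v. \<forall>\<^sub>F s in sequentially. g x s = v"
    and meets: "\<And>R a. dec d (\<lambda>p. R (e1 p) (e2 p)) \<Longrightarrow> infinite {x. \<exists>t. R x t} \<Longrightarrow>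
           \<exists>x t. R x t \<and> (\<forall>\<^sub>F s in sequentially. g x s = a)"
    by (rule defeating_colouring[OF assms]) (rule that)
  have "stable2 g"
    using lim unfolding stable2_def eventually_sequentially by blast
  then have "inst STS2 (graph2 g)" unfolding inst_def STS2_def by auto
  moreover have "computable (graph2 g)"
  proof -
    have "dec {} (\<lambda>n. e1 (e1 n) < e2 (e1 n) \<and> e2 n = g (e1 (e1 n)) (e2 (e1 n)))"
      by (intro cf_intros cf_lift2[OF g])
    moreover have "n \<in> graph2 g \<longleftrightarrow> e1 (e1 n) < e2 (e1 n) \<and> e2 n = g (e1 (e1 n)) (e2 (e1 n))" for n
    proof
      assume "e1 (e1 n) < e2 (e1 n) \<and> e2 n = g (e1 (e1 n)) (e2 (e1 n))"
      moreover from this have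
        "n = prod_encode (prod_encode (e1 (e1 n), e2 (e1 n)), g (e1 (e1 n)) (e2 (e1 n)))"
        by (metis pair_e)
      ultimately show "n \<in> graph2 g" unfolding graph2_def by blast
    qed (auto simp: graph2_def)
    ultimately show ?thesis unfolding computable_def turing_le_iff_dec by simp
  qed
  moreover have "\<not> sol STS2 (graph2 g) W" if W: "turing_le W d" for W
  proof
    assume "sol STS2 (graph2 g) W"
    then obtain g' a where inf: "infinite W" and eq: "graph2 g = graph2 g'"
      and a: "\<forall>x\<in>W. \<forall>s\<in>W. x < s \<longrightarrow> g' x s \<noteq> a"
      unfolding sol_def STS2_def by auto
    \<comment> \<open>A graph determines its colouring only on pairs \<open>x < s\<close>.\<close>
    have g': "g' x s = g x s" if "x < s" for x s
    proof -
      have "prod_encode (prod_encode (x, s), g x s) \<in> graph2 g'"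
        by (subst eq[symmetric]) (use that in \<open>auto simp: graph2_def\<close>)
      then show ?thesis unfolding graph2_def by auto
    qed
    have "dec d (\<lambda>p. e1 p \<in> W)"
      using W unfolding turing_le_iff_dec by (rule dec_comp) (intro cf_intros)
    from meets[of "\<lambda>x _. x \<in> W", OF this, of a] inf
    obtain x where x: "x \<in> W" "\<forall>\<^sub>F s in sequentially. g x s = a" by auto
    then obtain N where N: "\<forall>s\<ge>N. g x s = a" unfolding eventually_sequentially by blast
    obtain s where "s > max N x" "s \<in> W" using inf unfolding infinite_nat_iff_unbounded by blast
    then have "x < s" "g x s = a" using N by simp_all
    then show False using a x(1) \<open>s \<in> W\<close> g' by metis
  qed
  ultimately show ?thesis by blast
qed

text \<open>Transitivity propagates the relation; antisymmetry prevents the sequence from returning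
  to an earlier value.\<close>

lemma monotone_sequence:
  assumes "trans r" "antisym r" "\<And>n. (f n, f (Suc n)) \<in> r \<and> f n \<noteq> f (Suc n)" "m < n"
  shows "(f m, f n) \<in> r \<and> f m \<noteq> f n"
  using assms(4)
proof (induction rule: less_Suc_induct)
  case (2 i j k)
  then show ?case using assms(1,2) by (metis antisymD transD)
qed (rule assms(3))

text \<open>A monotone sequence through a point of limit colour \<open>0\<close> cannot ascend, and one through a point of limit
  colour \<open>1\<close> cannot descend.\<close>

lemma SADS_instance:
  assumes "low2 d"
  shows "\<exists>X. inst SADS X \<and> computable X \<and> (\<forall>W. turing_le W d \<longrightarrow> \<not> sol SADS X W)"
proof -
  obtain g where g: "cf {} (\<lambda>p. g (e1 p) (e2 p))"
    and cut: "\<And>x y z. x < y \<Longrightarrow> y < z \<Longrightarrow> g x y \<noteq> g x z \<Longrightarrow> g y z = g x z"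
    and lim: "\<And>x. \<exists>v. \<forall>\<^sub>F s in sequentially. g x s = v"
    and meets: "\<And>R a. dec d (\<lambda>p. R (e1 p) (e2 p)) \<Longrightarrow> infinite {x. \<exists>t. R x t} \<Longrightarrow>
           \<exists>x t. R x t \<and> (\<forall>\<^sub>F s in sequentially. g x s = a)"
    by (rule defeating_colouring[OF assms]) (rule that)
  \<comment> \<open>For \<open>x < s\<close>, colour 1 puts \<open>s\<close> above \<open>x\<close>,
    and every other colour puts it below.\<close>
  define B where "B a b \<longleftrightarrow> a = b \<or> a < b \<and> g a b = 1 \<or> b < a \<and> g b a \<noteq> 1" for a b
  define X where "X = {n. B (e1 n) (e2 n)}"
  have R: "rel_of X = {(a, b). B a b}" unfolding rel_of_def X_def by simp
  have B_antisym: "a = b" if "B a b" "B b a" for a b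
    using that unfolding B_def by auto
  have B_total: "B a b \<or> B b a" for a b
    unfolding B_def by (cases a b rule: linorder_cases) auto
  \<comment> \<open>Here \<open>a\<close> is numerically least and has different colours with
    \<open>b\<close> and \<open>c\<close>, so \<open>cut\<close> fixes the colour of the pair
    \<open>b\<close>, \<open>c\<close> against the cycle.\<close>
  have no_cycle: False if "a < b" "a < c" "b \<noteq> c" "B a b" "B b c" "B c a" for a b c
    using that cut[of a b c] cut[of a c b] unfolding B_def by (cases b c rule: linorder_cases) auto
  have B_trans: "B a c" if "B a b" "B b c" for a b c
  proof (rule ccontr)
    assume not: "\<not> B a c"
    have "B c a" using B_total[of a c] not by blast
    have "a \<noteq> c" using not unfolding B_def by blast
    have "a \<noteq> b" "b \<noteq> c" using that not by auto
    \<comment> \<open>The cycle is rotated so that its numerically least element comes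
      first.\<close>
    with \<open>a \<noteq> c\<close> consider "a < b" "a < c" | "b < c" "b < a" | "c < a" "c < b" by linarith
    then show False
      using that \<open>B c a\<close> \<open>a \<noteq> b\<close> \<open>b \<noteq> c\<close> \<open>a \<noteq> c\<close> no_cycle by cases metis+
  qed
  have tr: "trans (rel_of X)" unfolding R by (rule transI) (use B_trans in blast)
  have anti: "antisym (rel_of X)" unfolding R by (rule antisymI) (use B_antisym in blast)
  have lin: "linear_order_on UNIV (rel_of X)"
    unfolding linear_order_on_def partial_order_on_def preorder_on_def refl_on_def total_on_def
    using tr anti B_total unfolding R by blast
  have "finite {b. (b, a) \<in> rel_of X \<and> b \<noteq> a} \<or> finite {b. (a, b) \<in> rel_of X \<and> b \<noteq> a}" for a
  proof -
    obtain v N where N: "\<forall>s\<ge>N. g a s = v" using lim[of a] unfolding eventually_sequentially by blast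
    show ?thesis
    proof (cases "v = 1")
      case True
      have "b \<le> max N a" if "(b, a) \<in> rel_of X" for b
      proof (rule ccontr)
        assume "\<not> b \<le> max N a"
        then have "a < b" "g a b = v" using N by auto
        then show False using that \<open>v = 1\<close> unfolding R B_def by auto
      qed
      then have "{b. (b, a) \<in> rel_of X \<and> b \<noteq> a} \<subseteq> {..max N a}" by auto
      then show ?thesis using finite_subset by blast
    next
      case False
      have "b \<le> max N a" if "(a, b) \<in> rel_of X" for b
      proof (rule ccontr)
        assume "\<not> b \<le> max N a"
        then have "a < b" "g a b = v" using N by auto
        then show False using that \<open>v \<noteq> 1\<close> unfolding R B_def by auto
      qed
      then have "{b. (a, b) \<in> rel_of X \<and> b \<noteq> a} \<subseteq> {..max N a}" by auto
      then show ?thesis using finite_subset by blast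
    qed
  qed
  then have "inst SADS X" using lin unfolding inst_def SADS_def by (simp add: Let_def)
  moreover have "computable X"
    unfolding computable_def turing_le_iff_dec X_def B_def mem_Collect_eq
    by (intro cf_intros cf_lift2[OF g])
  moreover have "\<not> sol SADS X W" if W: "turing_le W d" for W
  proof
    assume "sol SADS X W"
    then obtain f where W_eq: "W = graph1 f" and
      f: "(\<forall>n. (f n, f (Suc n)) \<in> rel_of X \<and> f n \<noteq> f (Suc n)) \<or>
          (\<forall>n. (f (Suc n), f n) \<in> rel_of X \<and> f n \<noteq> f (Suc n))"
      unfolding sol_def SADS_def by (auto simp: Let_def)
    have mono: "(\<forall>m n. m < n \<longrightarrow> B (f m) (f n) \<and> f m \<noteq> f n) \<or>
        (\<forall>m n. m < n \<longrightarrow> B (f n) (f m) \<and> f m \<noteq> f n)"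
      using f
    proof
      assume "\<forall>n. (f n, f (Suc n)) \<in> rel_of X \<and> f n \<noteq> f (Suc n)"
      then show ?thesis using monotone_sequence[OF tr anti, of f] unfolding R by simp
    next
      assume "\<forall>n. (f (Suc n), f n) \<in> rel_of X \<and> f n \<noteq> f (Suc n)"
      \<comment> \<open>A descending sequence ascends in the converse relation.\<close>
      then show ?thesis using monotone_sequence[of "(rel_of X)\<inverse>" f] tr anti unfolding R by simp
    qed
    then have inj: "inj f" by (auto intro: linorder_injI)
    \<comment> \<open>With the components of the graph swapped, the range of \<open>f\<close>
      becomes a projection, as \<open>meets\<close> requires.\<close>
    have "dec d (\<lambda>p. prod_encode (e2 p, e1 p) \<in> W)"
      using W unfolding turing_le_iff_dec by (rule dec_comp) (intro cf_intros)
    moreover have graph: "prod_encode (n, x) \<in> W \<longleftrightarrow> x = f n" for n x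
      unfolding W_eq graph1_def by auto
    moreover have "{x. \<exists>n. x = f n} = range f" by auto
    ultimately have hit: "\<exists>n. \<forall>\<^sub>F s in sequentially. g (f n) s = a" for a
      using meets[of "\<lambda>x n. prod_encode (n, x) \<in> W" a] range_inj_infinite[OF inj] by auto
    have later: "\<exists>n>m. f n > b" for m b
    proof -
      have "infinite (f ` {m<..})"
        using inj by (simp add: finite_image_iff inj_on_subset infinite_Ioi)
      then show ?thesis unfolding infinite_nat_iff_unbounded by blast
    qed
    have point: "\<exists>m n. m < n \<and> f m < f n \<and> g (f m) (f n) = a" for a
    proof -
      obtain m N where "\<forall>s\<ge>N. g (f m) s = a" using hit unfolding eventually_sequentially by blast
      moreover obtain n where "n > m" "f n > max N (f m)" using later by blast
      ultimately show ?thesis by (intro exI[of _ m] exI[of _ n]) simp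
    qed
    \<comment> \<open>Colour 0 yields a descending pair of terms and colour 1 an ascending one; a
      monotone sequence cannot have both.\<close>
    obtain m n where mn: "m < n" "B (f n) (f m)" using point[of 0] unfolding B_def by auto
    obtain m' n' where mn': "m' < n'" "B (f m') (f n')" using point[of 1] unfolding B_def by auto
    show False using mono mn mn' B_antisym by meson
  qed
  ultimately show ?thesis by blast
qed

lemma no_universal_instance:
  assumes M: "omega_model P M" "\<forall>X\<in>M. low2 X" and "Q \<le>\<^sub>c P"
    and Q: "\<And>d. low2 d \<Longrightarrow> \<exists>X. inst Q X \<and> computable X \<and> (\<forall>W. turing_le W d \<longrightarrow> \<not> sol Q X W)"
  shows "\<not> admits_universal_instance P"
proof
  assume "admits_universal_instance P"
  then obtain U where U: "inst P U" "computable U" "\<forall>Y. sol P U Y \<longrightarrow> bounds Y P"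
    unfolding admits_universal_instance_def by blast
  have comp: "turing_le X A" if "computable X" for X A
    using that turing_le_empty unfolding computable_def by (rule turing_le_trans)
  \<comment> \<open>Being nonempty and closed downwards, \<open>M\<close> contains every computable
    set, in particular \<open>U\<close>.\<close>
  obtain A where "A \<in> M" using M(1) unfolding omega_model_def by blast
  then have "U \<in> M" using M(1) comp[OF U(2), of A] unfolding omega_model_def by simp
  then have "\<exists>d\<in>M. sol P U d" using M(1) U(1) unfolding omega_model_def by simp
  then obtain d where d: "d \<in> M" "sol P U d" by blast
  then obtain X where X: "inst Q X" "computable X" "\<forall>W. turing_le W d \<longrightarrow> \<not> sol Q X W"
    using Q M(2) by metis
  then obtain Y where Y: "turing_le Y X" "inst P Y"
    "\<forall>Z. sol P Y Z \<longrightarrow> (\<exists>W. turing_le W (join Z X) \<and> sol Q X W)"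
    using \<open>Q \<le>\<^sub>c P\<close> unfolding comp_reducible_def by metis
  have "computable Y" using Y(1) X(2) unfolding computable_def by (rule turing_le_trans)
  moreover have "bounds d P" using U(3) d(2) by simp
  ultimately obtain Z where Z: "sol P Y Z" "turing_le Z d"
    using Y(2) unfolding bounds_def by auto
  obtain W where W: "turing_le W (join Z X)" "sol Q X W" using Y(3) Z(1) by auto
  \<comment> \<open>Since \<open>X\<close> is computable, joining it to \<open>Z\<close> does not
    lead beyond \<open>d\<close>.\<close>
  from W(1) turing_le_join[OF Z(2) comp[OF X(2)]] have "turing_le W d" by (rule turing_le_trans)
  then show False using X(3) W(2) by simp
qed

theorem theorem4p2:
  fixes P :: principle
  assumes "is_principle P"
    and "\<exists>M. omega_model P M \<and> (\<forall>X\<in>M. low2 X)"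
    and "STS2 \<le>\<^sub>c P \<or> SADS \<le>\<^sub>c P"
  shows "\<not> admits_universal_instance P"
proof -
  obtain M where M: "omega_model P M" "\<forall>X\<in>M. low2 X" using assms(2) by blast
  show ?thesis
    using assms(3) no_universal_instance[OF M _ STS2_instance]
      no_universal_instance[OF M _ SADS_instance] by (rule disjE)
qed

end
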